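(* Consider the misspecified Bernoulli sampling model with two agents (described in the context). There is a random variable $M(\infty)\in[0,1]$, not depending on the agent $i\in\{1,2\}$, such that, almost surely, for $i=1,2$, the misspecified posteriors $\widetilde{\nu}_i(t)$ converge weakly, as $t\to\infty$, to the point mass $\delta_{M(\infty)}$ in the space of probability measures on $[0,1]$. Furthermore, $M(\infty)$ differs from the optimal Bayes posterior mean almost surely: $$\mathbb{P}\big(M(\infty)\neq\mathbb{E}[\theta\mid S_1,S_2]\big)=1.$$
   Context: Misspecified Bernoulli sampling model. There are two agents, $1$ and $2$, who communicate with each other. The state $\theta$ is uniform on $[0,1]$, and given $\theta$ the signals $S_1,S_2\sim\mathrm{Ber}(\theta)$ are conditionally independent. For $z_1,\dots,z_m\in\{0,1\}$ let $$\widetilde{p}(\theta\mid z_1,\dots,z_m):=\mathrm{Law}(\theta\mid Z_1=z_1,\dots,Z_m=z_m),$$ where $\theta\sim\mathrm{Unif}([0,1])$ and, given $\theta$, $Z_1,\dots,Z_m$ are i.i.d. $\mathrm{Ber}(\theta)$. For $t=1,2,\dots$ define the (misspecified) posteriors $$\widetilde{\nu}_1(t):=\widetilde{p}\big(\theta\mid S_1,(\widetilde{X}_2(s))_{1\le s<t}\big),\qquad \widetilde{\nu}_2(t):=\widetilde{p}\big(\theta\mid S_2,(\widetilde{X}_1(s))_{1\le s<t}\big).$$ At time $t$, each agent $i\in\{1,2\}$ samples $\widetilde{Y}_i(t)\sim\widetilde{\nu}_i(t)$ and then $\widetilde{X}_i(t)\sim\mathrm{Ber}(\widetilde{Y}_i(t))$,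 conditionally independently of all other random variables (in particular of the other agent's time-$t$ sampling) given the past, and sends $\widetilde{X}_i(t)$ to the other agent. *)

theory Defs
  imports "HOL-Probability.Probability"
begin

datatype agent = Agent1 | Agent2

fun other :: "agent \<Rightarrow> agent" where
  "other Agent1 = Agent2"
| "other Agent2 = Agent1"

(* Joint law of (theta, [Z_1, ..., Z_m]) with theta ~ Unif([0,1]) and Z_1, ..., Z_m i.i.d. Ber(theta)
   given theta.  The outcome True stands for 1 and False for 0. *)
definition bernoulli_joint :: "nat \<Rightarrow> (real \<times> bool list) measure" where
  "bernoulli_joint m =
     uniform_measure lborel {0..1} \<bind>
       (\<lambda>\<theta>. distr (measure_pmf (replicate_pmf m (bernoulli_pmf \<theta>)))
          (borel \<Otimes>\<^sub>M count_space UNIV) (\<lambda>zs. (\<theta>, zs)))"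

(* Law(theta | Z_1 = z_1, ..., Z_m = z_m), as a Borel measure on the real line.  The conditioning event
   has positive probability for every zs, so this is elementary conditioning. *)
definition bernoulli_posterior :: "bool list \<Rightarrow> real measure" where
  "bernoulli_posterior zs =
     distr (uniform_measure (bernoulli_joint (length zs)) {p. snd p = zs}) borel fst"

(* The posterior of agent i at time t \<ge> 1, computed as if all the bits received so far were
   i.i.d. samples from Ber(theta). *)
definition misspec_posterior ::
  "(agent \<Rightarrow> 'a \<Rightarrow> bool) \<Rightarrow> (agent \<Rightarrow> nat \<Rightarrow> 'a \<Rightarrow> bool) \<Rightarrow> agent \<Rightarrow> nat \<Rightarrow> 'a \<Rightarrow> real measure" where
  "misspec_posterior S X i t \<omega> =
     bernoulli_posterior (S i \<omega> # map (\<lambda>s. X (other i) s \<omega>) [1..<t])"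

definition preimages :: "'a measure \<Rightarrow> 'b measure \<Rightarrow> ('a \<Rightarrow> 'b) \<Rightarrow> 'a set set" where
  "preimages M N f = {f -` A \<inter> space M | A. A \<in> sets N}"

(* Sigma-algebra generated by theta, the signals and everything sampled at the times 1, ..., t - 1. *)
definition past ::
  "'a measure \<Rightarrow> ('a \<Rightarrow> real) \<Rightarrow> (agent \<Rightarrow> 'a \<Rightarrow> bool) \<Rightarrow> (agent \<Rightarrow> nat \<Rightarrow> 'a \<Rightarrow> real) \<Rightarrow>
   (agent \<Rightarrow> nat \<Rightarrow> 'a \<Rightarrow> bool) \<Rightarrow> nat \<Rightarrow> 'a measure" where
  "past M \<theta> S Y X t =
     sigma (space M)
       (preimages M borel \<theta> \<union>
        (\<Union>i. preimages M (count_space UNIV) (S i)) \<union>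
        (\<Union>i. \<Union>s\<in>{1..<t}. preimages M borel (Y i s) \<union> preimages M (count_space UNIV) (X i s)))"

(* The past together with the two posterior samples drawn at time t. *)
definition past_and_samples ::
  "'a measure \<Rightarrow> ('a \<Rightarrow> real) \<Rightarrow> (agent \<Rightarrow> 'a \<Rightarrow> bool) \<Rightarrow> (agent \<Rightarrow> nat \<Rightarrow> 'a \<Rightarrow> real) \<Rightarrow>
   (agent \<Rightarrow> nat \<Rightarrow> 'a \<Rightarrow> bool) \<Rightarrow> nat \<Rightarrow> 'a measure" where
  "past_and_samples M \<theta> S Y X t =
     sigma (space M)
       (sets (past M \<theta> S Y X t) \<union> (\<Union>i. preimages M borel (Y i t)))"

(* kappa is a version of the conditional law, given the sub-sigma-algebra F, of the N-valued random
   variable V. *)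
definition has_cond_law ::
  "'a measure \<Rightarrow> 'a measure \<Rightarrow> 'b measure \<Rightarrow> ('a \<Rightarrow> 'b) \<Rightarrow> ('a \<Rightarrow> 'b measure) \<Rightarrow> bool" where
  "has_cond_law M F N V \<kappa> \<longleftrightarrow>
     (\<forall>A\<in>sets N. AE \<omega> in M.
        real_cond_exp M F (indicator (V -` A \<inter> space M)) \<omega> = measure (\<kappa> \<omega>) A)"

(* Product laws in signals, samples and messages encode the conditional independence of the two
   agents. *)
locale misspecified_bernoulli_sampling = prob_space M
  for M :: "'a measure" +
  fixes \<theta> :: "'a \<Rightarrow> real"
    and S :: "agent \<Rightarrow> 'a \<Rightarrow> bool"
    and Y :: "agent \<Rightarrow> nat \<Rightarrow> 'a \<Rightarrow> real"
    and X :: "agent \<Rightarrow> nat \<Rightarrow> 'a \<Rightarrow> bool"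
  assumes measurable_state: "\<theta> \<in> borel_measurable M"
    and measurable_signal: "\<And>i. S i \<in> measurable M (count_space UNIV)"
    and measurable_sample: "\<And>i t. 1 \<le> t \<Longrightarrow> Y i t \<in> borel_measurable M"
    and measurable_message: "\<And>i t. 1 \<le> t \<Longrightarrow> X i t \<in> measurable M (count_space UNIV)"
    and state: "distr M borel \<theta> = uniform_measure lborel {0..1}"
    and signals:
      "has_cond_law M (vimage_algebra (space M) \<theta> borel) (count_space UNIV)
         (\<lambda>\<omega>. (S Agent1 \<omega>, S Agent2 \<omega>))
         (\<lambda>\<omega>. measure_pmf (pair_pmf (bernoulli_pmf (\<theta> \<omega>)) (bernoulli_pmf (\<theta> \<omega>))))"
    and samples:
      "\<And>t. 1 \<le> t \<Longrightarrow>
         has_cond_law M (past M \<theta> S Y X t) (borel \<Otimes>\<^sub>M borel)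
           (\<lambda>\<omega>. (Y Agent1 t \<omega>, Y Agent2 t \<omega>))
           (\<lambda>\<omega>. misspec_posterior S X Agent1 t \<omega> \<Otimes>\<^sub>M misspec_posterior S X Agent2 t \<omega>)"
    and messages:
      "\<And>t. 1 \<le> t \<Longrightarrow>
         has_cond_law M (past_and_samples M \<theta> S Y X t) (count_space UNIV)
           (\<lambda>\<omega>. (X Agent1 t \<omega>, X Agent2 t \<omega>))
           (\<lambda>\<omega>. measure_pmf (pair_pmf (bernoulli_pmf (Y Agent1 t \<omega>)) (bernoulli_pmf (Y Agent2 t \<omega>))))"

(* E[theta | S_1, S_2] *)
definition bayes_posterior_mean ::
  "'a measure \<Rightarrow> ('a \<Rightarrow> real) \<Rightarrow> (agent \<Rightarrow> 'a \<Rightarrow> bool) \<Rightarrow> 'a \<Rightarrow> real" where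
  "bayes_posterior_mean M \<theta> S =
     real_cond_exp M
       (vimage_algebra (space M) (\<lambda>\<omega>. (S Agent1 \<omega>, S Agent2 \<omega>)) (count_space UNIV)) \<theta>"

end

theory Submission
  imports Defs "HOL-Real_Asymp.Real_Asymp"
begin

text \<open>
  A posterior based on \<open>n\<close> bits, \<open>k\<close> of them ones, is the Beta law with density proportional to
  \<open>x ^ k * (1 - x) ^ (n - k)\<close>.  Its mean is \<open>(1 + k) / (n + 2)\<close> and its variance is at most
  \<open>1 / (n + 3)\<close>, so it concentrates as bits accumulate, and the weak convergence of the posteriors
  reduces to the convergence of the posterior means \<open>m1 t\<close>, \<open>m2 t\<close> of the two agents.  Integrating
  out the posterior samples, the two messages at time \<open>t\<close> are, given the past, independent Bernoulli
  variables with parameters \<open>m1 t\<close> and \<open>m2 t\<close>: the pair of means is a pair of Polya urns, each of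
  which is fed with the draws of the other one.

  Convergence.  Write \<open>W t = (m1 t + m2 t) / 2\<close>.  This is a martingale whose step at time \<open>t\<close> is at
  most \<open>1 / (t + 3)\<close>, so that \<open>W r - W s\<close> has second moment at most \<open>1 / s\<close> for \<open>r \<ge> s\<close>.  The rescaled
  difference \<open>(t + 2) * (m1 t - m2 t)\<close> is pulled towards 0 and has second moment at most \<open>t\<close>, so that
  \<open>m1 t - m2 t\<close> has second moment at most \<open>1 / t\<close>.  Along the times \<open>n ^ 4\<close> these bounds are summable and
  give almost sure convergence to a common limit \<open>W\<^sub>\<infinity>\<close>; between these times the means hardly move.

  The limit has no atom in the open unit interval.  Fix \<open>c\<close> and a large time \<open>s\<close>, and suppose that at
  time \<open>s\<close> both means are at distance at least \<open>\<eta>\<close> from 0 and 1.  They stay away from 0 and 1 during a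
  fixed proportion of \<open>s\<close> further steps, and the independence of the two messages then yields a
  conditional variance of \<open>W\<^sub>\<infinity>\<close> of order exactly \<open>1 / s\<close>.  Given the past, the second moment of \<open>W\<^sub>\<infinity> - c\<close>
  is therefore comparable with \<open>v = (W s - c)\<^sup>2 + 1 / s\<close>, and its fourth moment is at most of order \<open>v\<^sup>2\<close>.
  By the second moment method the conditional probability of \<open>W\<^sub>\<infinity> \<noteq> c\<close> is at least some \<open>\<delta> > 0\<close>, and
  \<open>\<delta>\<close> depends on \<open>\<eta>\<close> only (lemma \<open>anti_concentration\<close>).  On the event \<open>W\<^sub>\<infinity> = c\<close> this conditional
  probability would have to tend to 0, so the event is null.  Concretely, the bound is averaged against
  a continuous function of the means at time \<open>s\<close> that is peaked at \<open>c\<close>, then \<open>s\<close> tends to infinity and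
  the peak is narrowed (lemma \<open>consensus_no_atom\<close>).

  The optimal posterior mean is a function of the two signals, hence takes finitely many values, and
  these lie in the open unit interval because the state does.  So \<open>W\<^sub>\<infinity>\<close> almost surely avoids it.
\<close>

section \<open>The posterior is a Beta law\<close>

text \<open>
  \<^const>\<open>bernoulli_pmf\<close> truncates its parameter to the unit interval, and the truncation is kept
  explicit: the posterior samples are arbitrary real random variables that lie in the unit interval only
  almost surely.
\<close>

lemma pmf_bernoulli_clamp:
  "pmf (bernoulli_pmf p) b = (if b then min 1 (max 0 p) else 1 - min 1 (max 0 p))"
  by (simp add: bernoulli_pmf.rep_eq)

lemma pmf_replicate_bernoulli:
  "pmf (replicate_pmf (length zs) (bernoulli_pmf p)) zs =
     min 1 (max 0 p) ^ count_list zs True * (1 - min 1 (max 0 p)) ^ count_list zs False"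
proof (induction zs)
  case (Cons z zs)
  let ?p = "bernoulli_pmf p" and ?r = "replicate_pmf (length zs) (bernoulli_pmf p)"
  have "replicate_pmf (length (z # zs)) ?p = map_pmf (\<lambda>(x, xs). x # xs) (pair_pmf ?p ?r)"
    by (simp add: pair_pmf_def map_bind_pmf)
  also have "pmf \<dots> (z # zs) = pmf (pair_pmf ?p ?r) (z, zs)"
    using pmf_map_inj'[of "\<lambda>(x, xs). x # xs" "pair_pmf ?p ?r" "(z, zs)"] by (auto simp: inj_def)
  finally show ?case
    using Cons.IH by (simp add: pmf_pair pmf_bernoulli_clamp)
qed simp

lemma bernoulli_kernel_measurable:
  "(\<lambda>\<theta>. distr (measure_pmf (replicate_pmf m (bernoulli_pmf \<theta>)))
      (borel \<Otimes>\<^sub>M count_space UNIV) (\<lambda>zs. (\<theta>, zs)))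
   \<in> measurable (borel :: real measure) (subprob_algebra (borel \<Otimes>\<^sub>M count_space UNIV))"
  (is "?K \<in> _")
proof (rule measurable_subprob_algebra)
  fix \<theta> :: real
  show "subprob_space (?K \<theta>)"
    by (intro prob_space_imp_subprob_space prob_space.prob_space_distr prob_space_measure_pmf)
       (simp add: space_pair_measure)
next
  fix A :: "(real \<times> bool list) set"
  assume A: "A \<in> sets (borel \<Otimes>\<^sub>M count_space UNIV)"
  let ?L = "{zs :: bool list. length zs = m}"
  have fin: "finite ?L"
    using finite_lists_length_eq[of "UNIV :: bool set" m] by simp
  have eq: "emeasure (?K \<theta>) A = (\<Sum>zs\<in>?L. ennreal (pmf (replicate_pmf m (bernoulli_pmf \<theta>)) zs) *
              indicator A (\<theta>, zs))" for \<theta>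
  proof -
    have sub: "set_pmf (replicate_pmf m (bernoulli_pmf \<theta>)) \<subseteq> ?L"
      by (auto simp: set_replicate_pmf)
    have "emeasure (?K \<theta>) A =
      (\<integral>\<^sup>+p. indicator A p \<partial>?K \<theta>)"
      using A by (subst nn_integral_indicator) auto
    also have "\<dots> = (\<integral>\<^sup>+zs. indicator A (\<theta>, zs) \<partial>measure_pmf (replicate_pmf m (bernoulli_pmf \<theta>)))"
      using A by (intro nn_integral_distr) (auto simp: space_pair_measure)
    also have "\<dots> = (\<Sum>zs\<in>?L. indicator A (\<theta>, zs) * ennreal (pmf (replicate_pmf m (bernoulli_pmf \<theta>)) zs))"
      using sub fin by (intro nn_integral_measure_pmf_support) (auto simp: set_pmf_iff)
    finally show ?thesis
      by (simp add: mult.commute)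
  qed
  have "(\<lambda>\<theta>. \<Sum>zs\<in>?L. ennreal (pmf (replicate_pmf m (bernoulli_pmf \<theta>)) zs) * indicator A (\<theta>, zs))
      \<in> borel_measurable borel"
  proof (intro borel_measurable_sum borel_measurable_times_ennreal)
    fix zs assume "zs \<in> ?L"
    then have pm: "(\<lambda>\<theta>. pmf (replicate_pmf m (bernoulli_pmf \<theta>)) zs) =
       (\<lambda>\<theta>. min 1 (max 0 \<theta>) ^ count_list zs True * (1 - min 1 (max 0 \<theta>)) ^ count_list zs False)"
      by (auto simp: pmf_replicate_bernoulli)
    have "(\<lambda>\<theta>. pmf (replicate_pmf m (bernoulli_pmf \<theta>)) zs) \<in> borel_measurable borel"
      unfolding pm by measurable
    then show "(\<lambda>\<theta>. ennreal (pmf (replicate_pmf m (bernoulli_pmf \<theta>)) zs)) \<in> borel_measurable borel"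
      by measurable
    show "(\<lambda>\<theta>. indicator A (\<theta>, zs) :: ennreal) \<in> borel_measurable borel"
      using A by measurable
  qed
  then show "(\<lambda>\<theta>. emeasure (?K \<theta>) A) \<in> borel_measurable borel"
    unfolding eq .
qed auto

text \<open>
  The Beta integral has real powers in its integrand; since \<open>0 powr 0 = 0\<close> but \<open>0 ^ 0 = 1\<close>, the two
  integrands are compared on the open interval.
\<close>

lemma nn_integral_beta_weight:
  "(\<integral>\<^sup>+x. ennreal (x ^ k * (1 - x) ^ l) * indicator {0..1} x \<partial>lborel) =
     ennreal (Beta (real k + 1) (real l + 1))"
proof -
  have "((\<lambda>t. t powr (real k + 1 - 1) * (1 - t) powr (real l + 1 - 1)) has_integral
          Beta (real k + 1) (real l + 1)) {0<..<1}"
    using has_integral_Beta_real[of "real k + 1" "real l + 1"] by (simp add: has_integral_Icc_iff_Ioo)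
  then have "((\<lambda>t::real. t ^ k * (1 - t) ^ l) has_integral Beta (real k + 1) (real l + 1)) {0<..<1}"
    by (rule has_integral_eq[rotated]) (auto simp: powr_realpow)
  then have "((\<lambda>t::real. t ^ k * (1 - t) ^ l) has_integral Beta (real k + 1) (real l + 1)) {0..1}"
    by (simp add: has_integral_Icc_iff_Ioo)
  from nn_integral_has_integral_lebesgue[OF _ this]
  have "(\<integral>\<^sup>+x. ennreal (indicator {0..1} x * (x ^ k * (1 - x) ^ l)) \<partial>lborel) =
      ennreal (Beta (real k + 1) (real l + 1))"
    by simp
  also have "(\<integral>\<^sup>+x. ennreal (indicator {0..1} x * (x ^ k * (1 - x) ^ l)) \<partial>lborel) =
      (\<integral>\<^sup>+x. ennreal (x ^ k * (1 - x) ^ l) * indicator {0..1} x \<partial>lborel)"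
    by (intro nn_integral_cong) (auto simp: indicator_def)
  finally show ?thesis .
qed

lemma Beta_pos: "x > 0 \<Longrightarrow> y > 0 \<Longrightarrow> Beta x (y::real) > 0"
  by (simp add: Beta_def Gamma_real_pos)

lemma emeasure_bernoulli_joint:
  assumes A: "A \<in> sets borel"
  shows "emeasure (bernoulli_joint (length zs)) (A \<times> {zs}) =
    (\<integral>\<^sup>+x. ennreal (x ^ count_list zs True * (1 - x) ^ count_list zs False) * indicator {0..1} x * indicator A x \<partial>lborel)"
proof -
  let ?K = "\<lambda>\<theta>. distr (measure_pmf (replicate_pmf (length zs) (bernoulli_pmf \<theta>)))
      (borel \<Otimes>\<^sub>M count_space UNIV) (\<lambda>zs. (\<theta>, zs))"
  let ?U = "uniform_measure lborel {0..1::real}"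
  have mK: "?K \<in> measurable ?U (subprob_algebra (borel \<Otimes>\<^sub>M count_space UNIV))"
    using bernoulli_kernel_measurable[of "length zs"] by (simp cong: measurable_cong_sets)
  have K: "emeasure (?K \<theta>) (A \<times> {zs}) =
     ennreal (min 1 (max 0 \<theta>) ^ count_list zs True * (1 - min 1 (max 0 \<theta>)) ^ count_list zs False) * indicator A \<theta>" for \<theta>
  proof -
    have "emeasure (?K \<theta>) (A \<times> {zs}) = emeasure (measure_pmf (replicate_pmf (length zs) (bernoulli_pmf \<theta>))) (if \<theta> \<in> A then {zs} else {})"
      using A by (subst emeasure_distr) (auto simp: space_pair_measure intro!: arg_cong2[where f=emeasure])
    then show ?thesis
      by (simp add: emeasure_pmf_single pmf_replicate_bernoulli)
  qed
  have "emeasure (bernoulli_joint (length zs)) (A \<times> {zs}) = (\<integral>\<^sup>+\<theta>. emeasure (?K \<theta>) (A \<times> {zs}) \<partial>?U)"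
    unfolding bernoulli_joint_def using A by (intro emeasure_bind[OF _ mK]) auto
  also have "\<dots> = (\<integral>\<^sup>+\<theta>. ennreal (min 1 (max 0 \<theta>) ^ count_list zs True * (1 - min 1 (max 0 \<theta>)) ^ count_list zs False) * indicator A \<theta> * indicator {0..1} \<theta> \<partial>lborel)"
    unfolding K using A by (subst nn_integral_uniform_measure) (auto simp: divide_ennreal_def)
  also have "\<dots> = (\<integral>\<^sup>+x. ennreal (x ^ count_list zs True * (1 - x) ^ count_list zs False) * indicator {0..1} x * indicator A x \<partial>lborel)"
    by (intro nn_integral_cong) (auto simp: indicator_def)
  finally show ?thesis .
qed

lemma bernoulli_posterior_eq_beta_density:
  "bernoulli_posterior zs = density lborel
     (\<lambda>x. ennreal (x ^ count_list zs True * (1 - x) ^ count_list zs False /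
        Beta (real (count_list zs True) + 1) (real (count_list zs False) + 1)) * indicator {0..1} x)"
  (is "_ = density lborel (\<lambda>x. ennreal (?w x / ?B) * _)")
proof (rule measure_eqI)
  show "sets (bernoulli_posterior zs) = sets (density lborel (\<lambda>x. ennreal (?w x / ?B) * indicator {0..1} x))"
    by (simp add: bernoulli_posterior_def)
  fix A assume "A \<in> sets (bernoulli_posterior zs)"
  then have A: "A \<in> sets borel" by (simp add: bernoulli_posterior_def)
  have B: "?B > 0" by (intro Beta_pos) auto
  let ?J = "bernoulli_joint (length zs)"
  have setsJ: "sets ?J = sets (borel \<Otimes>\<^sub>M count_space UNIV)"
    unfolding bernoulli_joint_def by (intro sets_bind) auto
  then have spJ: "space ?J = UNIV"
    by (simp add: sets_eq_imp_space_eq[OF setsJ] space_pair_measure)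
  have eq: "{p. snd p = zs} = UNIV \<times> {zs}" by auto
  have m: "A' \<times> {zs} \<in> sets ?J" if "A' \<in> sets borel" for A'
    unfolding setsJ using that by auto
  have "fst -` A = A \<times> (UNIV :: bool list set)" by auto
  then have "emeasure (bernoulli_posterior zs) A = emeasure (uniform_measure ?J (UNIV \<times> {zs})) (A \<times> UNIV)"
    unfolding bernoulli_posterior_def eq using A
    by (subst emeasure_distr) (auto simp: spJ setsJ cong: measurable_cong_sets intro!: arg_cong2[where f=emeasure])
  also have "\<dots> = emeasure ?J (A \<times> {zs}) / emeasure ?J (UNIV \<times> {zs})"
  proof -
    have "A \<times> UNIV \<in> sets ?J" unfolding setsJ using A by auto
    moreover have "UNIV \<times> {zs} \<inter> A \<times> UNIV = A \<times> {zs}" by auto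
    ultimately show ?thesis
      using m[of UNIV] by (subst emeasure_uniform_measure) auto
  qed
  also have "emeasure ?J (UNIV \<times> {zs}) = ennreal ?B"
    using nn_integral_beta_weight by (subst emeasure_bernoulli_joint) auto
  also have "emeasure ?J (A \<times> {zs}) / ennreal ?B = (\<integral>\<^sup>+x. ennreal (?w x) * indicator {0..1} x * indicator A x / ennreal ?B \<partial>lborel)"
    using A by (subst emeasure_bernoulli_joint[OF A], subst nn_integral_divide) auto
  also have "\<dots> = (\<integral>\<^sup>+x. ennreal (?w x / ?B) * indicator {0..1} x * indicator A x \<partial>lborel)"
    using B by (intro nn_integral_cong) (auto simp: indicator_def divide_ennreal)
  also have "\<dots> = emeasure (density lborel (\<lambda>x. ennreal (?w x / ?B) * indicator {0..1} x)) A"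
    using A by (subst emeasure_density) auto
  finally show "emeasure (bernoulli_posterior zs) A = \<dots>" .
qed

lemma sets_bernoulli_posterior [measurable_cong]: "sets (bernoulli_posterior zs) = sets borel"
  by (simp add: bernoulli_posterior_def)

lemma space_bernoulli_posterior [simp]: "space (bernoulli_posterior zs) = UNIV"
  by (simp add: bernoulli_posterior_def)

lemma bernoulli_posterior_moment:
  fixes zs :: "bool list" and j :: nat
  defines "k \<equiv> count_list zs True" and "l \<equiv> count_list zs False"
  shows "(\<integral>\<^sup>+x. ennreal (x ^ j) * indicator {0..1} x \<partial>bernoulli_posterior zs) =
    ennreal (Beta (real (k + j) + 1) (real l + 1) / Beta (real k + 1) (real l + 1))"
proof -
  let ?B = "Beta (real k + 1) (real l + 1)"
  have B: "?B > 0" by (intro Beta_pos) auto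
  have "(\<integral>\<^sup>+x. ennreal (x ^ j) * indicator {0..1} x \<partial>bernoulli_posterior zs) =
     (\<integral>\<^sup>+x. ennreal (x ^ k * (1 - x) ^ l / ?B) * indicator {0..1} x * (ennreal (x ^ j) * indicator {0..1} x) \<partial>lborel)"
    unfolding bernoulli_posterior_eq_beta_density k_def l_def by (subst nn_integral_density) auto
  also have "\<dots> = (\<integral>\<^sup>+x. (ennreal (x ^ (k + j) * (1 - x) ^ l) * indicator {0..1} x) / ennreal ?B \<partial>lborel)"
    using B by (intro nn_integral_cong)
      (auto simp: indicator_def divide_ennreal power_add mult_ac simp flip: ennreal_mult)
  also have "\<dots> = ennreal (Beta (real (k + j) + 1) (real l + 1)) / ennreal ?B"
    using nn_integral_beta_weight[of "k + j" l] by (subst nn_integral_divide) auto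
  also have "\<dots> = ennreal (Beta (real (k + j) + 1) (real l + 1) / ?B)"
    using B by (intro divide_ennreal) (auto intro!: less_imp_le Beta_pos)
  finally show ?thesis .
qed

lemma prob_space_bernoulli_posterior: "prob_space (bernoulli_posterior zs)"
proof
  let ?k = "count_list zs True" and ?l = "count_list zs False"
  have B: "Beta (real ?k + 1) (real ?l + 1) > 0" by (intro Beta_pos) auto
  have "emeasure (bernoulli_posterior zs) UNIV =
     (\<integral>\<^sup>+x. ennreal (x ^ ?k * (1 - x) ^ ?l / Beta (real ?k + 1) (real ?l + 1)) * indicator {0..1} x \<partial>lborel)"
    unfolding bernoulli_posterior_eq_beta_density by (subst emeasure_density) auto
  also have "\<dots> = (\<integral>\<^sup>+x. (ennreal (x ^ ?k * (1 - x) ^ ?l) * indicator {0..1} x) / ennreal (Beta (real ?k + 1) (real ?l + 1)) \<partial>lborel)"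
    using B by (intro nn_integral_cong) (auto simp: indicator_def divide_ennreal)
  also have "\<dots> = 1"
    using nn_integral_beta_weight[of ?k ?l] B by (subst nn_integral_divide) (auto simp: divide_ennreal)
  finally show "emeasure (bernoulli_posterior zs) (space (bernoulli_posterior zs)) = 1"
    by simp
qed

lemma AE_bernoulli_posterior: "AE x in bernoulli_posterior zs. x \<in> {0..1}"
  unfolding bernoulli_posterior_eq_beta_density by (subst AE_density) (auto simp: indicator_def)

definition post_mean :: "bool list \<Rightarrow> real" where
  "post_mean zs = (1 + real (count_list zs True)) / (real (length zs) + 2)"

lemma count_list_bool: "count_list zs True + count_list zs False = length zs"
  by (induction zs) auto

lemma post_mean_bounds: "0 < post_mean zs" "post_mean zs < 1"
  using count_list_bool[of zs] by (auto simp: post_mean_def field_simps)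

lemma Beta_ratio1:
  fixes a b :: real assumes "a > 0" "b > 0"
  shows "Beta (a + 1) b / Beta a b = a / (a + b)"
proof -
  have "a \<notin> \<int>\<^sub>\<le>\<^sub>0"
    using assms by (auto elim!: nonpos_Ints_cases)
  then show ?thesis
    using Beta_plus1_left[of a b] Beta_pos[OF assms] assms by (subst frac_eq_eq) (auto simp: mult.commute)
qed

lemma nn_integral_bernoulli_posterior_mean:
  "(\<integral>\<^sup>+x. ennreal (min 1 (max 0 x)) \<partial>bernoulli_posterior zs) = ennreal (post_mean zs)"
proof -
  let ?k = "count_list zs True" and ?l = "count_list zs False"
  have "(\<integral>\<^sup>+x. ennreal (min 1 (max 0 x)) \<partial>bernoulli_posterior zs) =
     (\<integral>\<^sup>+x. ennreal (x ^ 1) * indicator {0..1} x \<partial>bernoulli_posterior zs)"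
    by (intro nn_integral_cong_AE eventually_mono[OF AE_bernoulli_posterior]) (auto simp: indicator_def)
  also have "\<dots> = ennreal (Beta ((real ?k + 1) + 1) (real ?l + 1) / Beta (real ?k + 1) (real ?l + 1))"
    by (subst bernoulli_posterior_moment) (simp add: add_ac)
  also have "\<dots> = ennreal (post_mean zs)"
    by (subst Beta_ratio1) (auto simp: post_mean_def add_ac simp flip: count_list_bool)
  finally show ?thesis .
qed

text \<open>
  Bias-variance decomposition: for the Beta law with parameters \<open>a\<close>, \<open>b\<close> the variance is
  \<open>a * b / ((a + b)\<^sup>2 * (a + b + 1))\<close>, and \<open>a * b \<le> (a + b)\<^sup>2\<close>.
\<close>

lemma bernoulli_posterior_variance:
  "integrable (bernoulli_posterior zs) (\<lambda>x. (x - a)\<^sup>2)"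
  "(\<integral>x. (x - a)\<^sup>2 \<partial>bernoulli_posterior zs) \<le> 1 / (real (length zs) + 3) + (post_mean zs - a)\<^sup>2"
proof -
  let ?P = "bernoulli_posterior zs"
  interpret P: prob_space ?P by (rule prob_space_bernoulli_posterior)
  let ?k = "count_list zs True" and ?l = "count_list zs False"
  have int: "integrable ?P (\<lambda>x. x ^ j)" for j
    by (intro P.integrable_const_bound[where B=1] eventually_mono[OF AE_bernoulli_posterior])
       (auto simp: power_le_one abs_if)
  have nn: "(\<integral>\<^sup>+x. ennreal (x ^ j) \<partial>?P) = ennreal (\<integral>x. x ^ j \<partial>?P)" for j
    by (intro nn_integral_eq_integral int eventually_mono[OF AE_bernoulli_posterior]) auto
  have nn': "(\<integral>\<^sup>+x. ennreal (x ^ j) \<partial>?P) = (\<integral>\<^sup>+x. ennreal (x ^ j) * indicator {0..1} x \<partial>?P)" for j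
    by (intro nn_integral_cong_AE eventually_mono[OF AE_bernoulli_posterior]) (auto simp: indicator_def)
  have pos: "0 \<le> (\<integral>x. x ^ j \<partial>?P)" for j
    by (intro integral_nonneg_AE eventually_mono[OF AE_bernoulli_posterior]) auto
  have mom: "(\<integral>x. x ^ j \<partial>?P) = Beta (real (?k + j) + 1) (real ?l + 1) / Beta (real ?k + 1) (real ?l + 1)" for j
    using nn[of j] nn'[of j] bernoulli_posterior_moment[of zs j] pos[of j]
    by (intro ennreal_inj[THEN iffD1]) (auto intro!: divide_nonneg_nonneg less_imp_le[OF Beta_pos])
  define a1 where "a1 = real ?k + 1"
  define b1 where "b1 = real ?l + 1"
  have ab: "a1 > 0" "b1 > 0" by (auto simp: a1_def b1_def)
  have len: "real (length zs) + 2 = a1 + b1"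
    by (simp add: a1_def b1_def flip: count_list_bool)
  have m1: "(\<integral>x. x \<partial>?P) = a1 / (a1 + b1)"
    using mom[of 1] Beta_ratio1[OF ab] by (simp add: a1_def b1_def add_ac)
  have "(\<integral>x. x ^ 2 \<partial>?P) = Beta (a1 + 1 + 1) b1 / Beta (a1 + 1) b1 * (Beta (a1 + 1) b1 / Beta a1 b1)"
    using mom[of 2] Beta_pos[of "a1 + 1" b1] ab by (simp add: a1_def b1_def add_ac)
  also have "\<dots> = (a1 + 1) / (a1 + 1 + b1) * (a1 / (a1 + b1))"
    using Beta_ratio1[of "a1 + 1" b1] Beta_ratio1[OF ab] ab by simp
  finally have m2: "(\<integral>x. x ^ 2 \<partial>?P) = (a1 + 1) / (a1 + 1 + b1) * (a1 / (a1 + b1))" .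
  have e: "(\<lambda>x::real. (x - a)\<^sup>2) = (\<lambda>x. x ^ 2 - 2 * a * x + a\<^sup>2)"
    by (auto simp: power2_eq_square algebra_simps)
  show "integrable ?P (\<lambda>x. (x - a)\<^sup>2)"
    unfolding e using int[of 2] int[of 1] by auto
  have "(\<integral>x. (x - a)\<^sup>2 \<partial>?P) = (\<integral>x. x ^ 2 \<partial>?P) - 2 * a * (\<integral>x. x \<partial>?P) + a\<^sup>2"
    unfolding e using int[of 2] int[of 1] P.prob_space by simp
  also have "\<dots> = a1 * b1 / ((a1 + b1)\<^sup>2 * (a1 + b1 + 1)) + (a1 / (a1 + b1) - a)\<^sup>2"
  proof -
    have "a1 + b1 \<noteq> 0" "a1 + b1 + 1 \<noteq> 0" "a1 + 1 + b1 \<noteq> 0" using ab by linarith+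
    then show ?thesis unfolding m1 m2
      by (simp add: divide_simps) (simp add: power2_eq_square algebra_simps)
  qed
  also have "\<dots> \<le> 1 / (a1 + b1 + 1) + (a1 / (a1 + b1) - a)\<^sup>2"
  proof -
    have "a1 * b1 \<le> (a1 + b1)\<^sup>2"
      using ab by (auto simp: power2_eq_square algebra_simps intro!: add_nonneg_nonneg)
    then have "a1 * b1 / ((a1 + b1)\<^sup>2 * (a1 + b1 + 1)) \<le> (a1 + b1)\<^sup>2 / ((a1 + b1)\<^sup>2 * (a1 + b1 + 1))"
      using ab by (intro divide_right_mono) auto
    then show ?thesis using ab by simp
  qed
  also have "a1 + b1 + 1 = real (length zs) + 3"
    using len by simp
  also have "a1 / (a1 + b1) = post_mean zs"
    unfolding len[symmetric] by (simp add: post_mean_def a1_def add_ac)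
  finally show "(\<integral>x. (x - a)\<^sup>2 \<partial>?P) \<le> 1 / (real (length zs) + 3) + (post_mean zs - a)\<^sup>2" .
qed

text \<open>
  By Chebyshev, the mass outside a neighbourhood of \<open>a\<close> tends to 0.  The distribution function of the
  point mass jumps at \<open>a\<close>, so \<open>x = a\<close> is not a point at which convergence is demanded.
\<close>

lemma weak_conv_m_return_of_L2:
  fixes \<mu> :: "nat \<Rightarrow> real measure"
  assumes prob: "\<And>t. prob_space (\<mu> t)"
    and sets: "\<And>t. sets (\<mu> t) = sets borel"
    and int: "\<And>t. integrable (\<mu> t) (\<lambda>x. (x - a)\<^sup>2)"
    and lim: "(\<lambda>t. \<integral>x. (x - a)\<^sup>2 \<partial>\<mu> t) \<longlonglongrightarrow> 0"
  shows "weak_conv_m \<mu> (return borel a)"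
  unfolding weak_conv_m_def weak_conv_def
proof (intro allI impI)
  have cdf_return: "cdf (return borel a) x = (if a \<le> x then 1 else 0)" for x
    by (simp add: cdf_def measure_return)
  fix x assume cont: "isCont (cdf (return borel a)) x"
  have far: "measure (\<mu> t) A \<le> (\<integral>y. (y - a)\<^sup>2 \<partial>\<mu> t) / d\<^sup>2"
    if A: "A \<in> sets borel" "\<And>y. y \<in> A \<Longrightarrow> d \<le> \<bar>y - a\<bar>" and d: "d > 0" for A d t
  proof -
    interpret prob_space "\<mu> t" by (rule prob)
    have "A \<in> events" using A sets by simp
    then have "measure (\<mu> t) A = (\<integral>y. indicator A y \<partial>\<mu> t)"
      using sets.sets_into_space[of A "\<mu> t"] by (simp add: Int_absorb1 Int_absorb2)
    also have "\<dots> \<le> (\<integral>y. (y - a)\<^sup>2 / d\<^sup>2 \<partial>\<mu> t)"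
    proof (rule integral_mono)
      fix y
      show "indicator A y \<le> (y - a)\<^sup>2 / d\<^sup>2"
        using A(2)[of y] d power_mono[of d "\<bar>y - a\<bar>" 2] by (auto simp: indicator_def field_simps)
    qed (use int \<open>A \<in> events\<close> in \<open>auto intro!: integrable_real_indicator emeasure_finite simp: less_top[symmetric]\<close>)
    finally show ?thesis by simp
  qed
  consider "x < a" | "a < x" | "x = a" by linarith
  then show "(\<lambda>t. cdf (\<mu> t) x) \<longlonglongrightarrow> cdf (return borel a) x"
  proof cases
    case 1
    have "(\<lambda>t. measure (\<mu> t) {..x}) \<longlonglongrightarrow> 0"
    proof (rule tendsto_sandwich[OF always_eventually always_eventually tendsto_const])
      show "\<forall>t. measure (\<mu> t) {..x} \<le> (\<integral>y. (y - a)\<^sup>2 \<partial>\<mu> t) / (a - x)\<^sup>2"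
        using 1 by (intro allI far) auto
      show "(\<lambda>t. (\<integral>y. (y - a)\<^sup>2 \<partial>\<mu> t) / (a - x)\<^sup>2) \<longlonglongrightarrow> 0"
        using tendsto_divide[OF lim tendsto_const, of "(a - x)\<^sup>2"] 1 by simp
    qed auto
    then show ?thesis using 1 by (simp add: cdf_return) (simp add: cdf_def)
  next
    case 2
    have "(\<lambda>t. measure (\<mu> t) {x<..}) \<longlonglongrightarrow> 0"
    proof (rule tendsto_sandwich[OF always_eventually always_eventually tendsto_const])
      show "\<forall>t. measure (\<mu> t) {x<..} \<le> (\<integral>y. (y - a)\<^sup>2 \<partial>\<mu> t) / (x - a)\<^sup>2"
        using 2 by (intro allI far) auto
      show "(\<lambda>t. (\<integral>y. (y - a)\<^sup>2 \<partial>\<mu> t) / (x - a)\<^sup>2) \<longlonglongrightarrow> 0"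
        using tendsto_divide[OF lim tendsto_const, of "(x - a)\<^sup>2"] 2 by simp
    qed auto
    then have "(\<lambda>t. 1 - measure (\<mu> t) {x<..}) \<longlonglongrightarrow> 1 - 0"
      by (intro tendsto_intros)
    moreover have "1 - measure (\<mu> t) {x<..} = cdf (\<mu> t) x" for t
    proof -
      interpret prob_space "\<mu> t" by (rule prob)
      have "space (\<mu> t) = UNIV" using sets_eq_imp_space_eq[OF sets[of t]] by simp
      moreover have "UNIV - {x<..} = {..x}" by auto
      ultimately show ?thesis
        using prob_compl[of "{x<..}"] sets by (simp add: cdf_def)
    qed
    ultimately show ?thesis using 2 by (simp add: cdf_return)
  next
    case 3
    have "((\<lambda>y. cdf (return borel a) y) \<longlongrightarrow> cdf (return borel a) x) (at_left x)"
      using cont by (simp add: isCont_def filterlim_at_split)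
    then have "((\<lambda>y. 0::real) \<longlongrightarrow> cdf (return borel a) x) (at_left x)"
      by (rule Lim_transform_eventually)
         (auto simp: cdf_return 3 eventually_at_left_field intro!: exI[of _ "a - 1"])
    then show ?thesis
      using tendsto_unique[OF trivial_limit_at_left_real _ tendsto_const[of 0]] 3
      by (fastforce simp: cdf_return)
  qed
qed

lemma bernoulli_posterior_weak_conv:
  assumes len: "filterlim (\<lambda>t. length (zs t)) at_top sequentially"
    and mean: "(\<lambda>t. post_mean (zs t)) \<longlonglongrightarrow> a"
  shows "weak_conv_m (\<lambda>t. bernoulli_posterior (zs t)) (return borel a)"
proof (rule weak_conv_m_return_of_L2)
  show "(\<lambda>t. \<integral>x. (x - a)\<^sup>2 \<partial>bernoulli_posterior (zs t)) \<longlonglongrightarrow> 0"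
  proof (rule tendsto_sandwich[OF always_eventually always_eventually tendsto_const])
    show "\<forall>t. (\<integral>x. (x - a)\<^sup>2 \<partial>bernoulli_posterior (zs t)) \<le>
        1 / (real (length (zs t)) + 3) + (post_mean (zs t) - a)\<^sup>2"
      using bernoulli_posterior_variance(2) by blast
    have "(\<lambda>n. 1 / (real n + 3)) \<longlonglongrightarrow> 0"
      by real_asymp
    from filterlim_compose[OF this len]
    have "(\<lambda>t. 1 / (real (length (zs t)) + 3)) \<longlonglongrightarrow> 0" .
    moreover have "(\<lambda>t. (post_mean (zs t) - a)\<^sup>2) \<longlonglongrightarrow> (a - a)\<^sup>2"
      by (intro tendsto_intros mean)
    ultimately show "(\<lambda>t. 1 / (real (length (zs t)) + 3) + (post_mean (zs t) - a)\<^sup>2) \<longlonglongrightarrow> 0"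
      using tendsto_add by fastforce
  qed auto
qed (auto simp: prob_space_bernoulli_posterior sets_bernoulli_posterior bernoulli_posterior_variance(1))

section \<open>Conditional laws and sub-sigma-algebras\<close>

lemma preimages_subset_sets: "f \<in> measurable M N \<Longrightarrow> preimages M N f \<subseteq> sets M"
  by (auto simp: preimages_def)

lemma subalgebra_sigma: "G \<subseteq> sets M \<Longrightarrow> subalgebra M (sigma (space M) G)"
  using sets.space_closed[of M]
  by (auto simp: subalgebra_def sets_measure_of_conv intro: sets.sigma_sets_subset[THEN subsetD])

lemma measurable_sigma_preimages:
  assumes "f \<in> measurable M N" "preimages M N f \<subseteq> G" "G \<subseteq> sets M"
  shows "f \<in> measurable (sigma (space M) G) N"
proof (rule measurableI)
  fix x assume "x \<in> space (sigma (space M) G)"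
  then show "f x \<in> space N" using measurable_space[OF assms(1)] by (simp add: space_measure_of_conv)
next
  fix A assume "A \<in> sets N"
  then have "f -` A \<inter> space M \<in> G" using assms(2) by (auto simp: preimages_def)
  moreover have "G \<subseteq> Pow (space M)" using assms(3) sets.space_closed by blast
  ultimately show "f -` A \<inter> space (sigma (space M) G) \<in> sets (sigma (space M) G)"
    by auto
qed

lemma cond_law_integral:
  assumes M: "prob_space M" and sub: "subalgebra M F"
    and V: "V \<in> measurable M N" and law: "has_cond_law M F N V \<kappa>"
    and \<zeta>: "\<zeta> \<in> borel_measurable F" "\<And>\<omega>. \<bar>\<zeta> \<omega>\<bar> \<le> C"
    and A: "A \<in> sets N"
    and meas: "(\<lambda>\<omega>. measure (\<kappa> \<omega>) A) \<in> borel_measurable M"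
  shows "(\<integral>\<omega>. \<zeta> \<omega> * indicator A (V \<omega>) \<partial>M) = (\<integral>\<omega>. \<zeta> \<omega> * measure (\<kappa> \<omega>) A \<partial>M)"
proof -
  interpret prob_space M by fact
  interpret finite_measure_subalgebra M F by unfold_locales fact
  have [measurable]: "\<zeta> \<in> borel_measurable M"
    using measurable_from_subalg[OF sub \<zeta>(1)] .
  let ?I = "indicator (V -` A \<inter> space M) :: _ \<Rightarrow> real"
  have [measurable]: "V -` A \<inter> space M \<in> sets M" using V A by auto
  have int: "integrable M (\<lambda>\<omega>. \<zeta> \<omega> * ?I \<omega>)"
  proof (rule integrable_const_bound[where B=C])
    show "AE \<omega> in M. norm (\<zeta> \<omega> * ?I \<omega>) \<le> C"
      using order_trans[OF abs_ge_zero \<zeta>(2)] by (auto simp: abs_mult \<zeta>(2) indicator_def)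
  qed measurable
  have "(\<integral>\<omega>. \<zeta> \<omega> * indicator A (V \<omega>) \<partial>M) = (\<integral>\<omega>. \<zeta> \<omega> * ?I \<omega> \<partial>M)"
    by (intro Bochner_Integration.integral_cong) (auto simp: indicator_def)
  also have "\<dots> = (\<integral>\<omega>. \<zeta> \<omega> * real_cond_exp M F ?I \<omega> \<partial>M)"
    by (rule real_cond_exp_intg(2)[symmetric, OF int \<zeta>(1)]) simp
  also have "\<dots> = (\<integral>\<omega>. \<zeta> \<omega> * measure (\<kappa> \<omega>) A \<partial>M)"
  proof (rule integral_cong_AE)
    show "AE \<omega> in M. \<zeta> \<omega> * real_cond_exp M F ?I \<omega> = \<zeta> \<omega> * measure (\<kappa> \<omega>) A"
      using law A unfolding has_cond_law_def by (auto elim!: ballE[of _ _ A] eventually_mono)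
    show "(\<lambda>\<omega>. \<zeta> \<omega> * measure (\<kappa> \<omega>) A) \<in> borel_measurable M"
      using meas by measurable
    have [measurable]: "real_cond_exp M F ?I \<in> borel_measurable M" by simp
    show "(\<lambda>\<omega>. \<zeta> \<omega> * real_cond_exp M F ?I \<omega>) \<in> borel_measurable M"
      by measurable
  qed
  finally show ?thesis .
qed

text \<open>
  Weighting the probability by \<open>\<zeta>\<close>, the conditional law says that the law of \<open>V\<close> under the weighted
  measure is the mixture of the kernels \<open>\<kappa> \<omega>\<close>.  An equality of measures extends at once from
  indicators to all nonnegative integrands.
\<close>

lemma cond_law_nn_integral:
  assumes M: "prob_space M" and sub: "subalgebra M F"
    and V: "V \<in> measurable M N" and law: "has_cond_law M F N V \<kappa>"
    and \<kappa>: "\<kappa> \<in> measurable M (subprob_algebra N)"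
    and \<zeta>: "\<zeta> \<in> borel_measurable F" "\<And>\<omega>. 0 \<le> \<zeta> \<omega>" "\<And>\<omega>. \<zeta> \<omega> \<le> C"
    and g: "g \<in> borel_measurable N"
  shows "(\<integral>\<^sup>+\<omega>. ennreal (\<zeta> \<omega>) * g (V \<omega>) \<partial>M) = (\<integral>\<^sup>+\<omega>. ennreal (\<zeta> \<omega>) * (\<integral>\<^sup>+v. g v \<partial>\<kappa> \<omega>) \<partial>M)"
proof -
  interpret prob_space M by fact
  note V[measurable] g[measurable] \<kappa>[measurable]
  have [measurable]: "\<zeta> \<in> borel_measurable M"
    using measurable_from_subalg[OF sub \<zeta>(1)] .
  let ?D = "density M (\<lambda>\<omega>. ennreal (\<zeta> \<omega>))"
  have \<kappa>D: "\<kappa> \<in> measurable ?D (subprob_algebra N)" using \<kappa> by simp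
  have "distr ?D N V = ?D \<bind> \<kappa>"
  proof (rule measure_eqI)
    have "sets (?D \<bind> \<kappa>) = sets N"
      using sets_kernel[OF \<kappa>D] not_empty by (intro sets_bind) auto
    then show "sets (distr ?D N V) = sets (?D \<bind> \<kappa>)" by simp
    fix A assume "A \<in> sets (distr ?D N V)"
    then have A[measurable]: "A \<in> sets N" by simp
    have sp: "subprob_space (\<kappa> \<omega>)" if "\<omega> \<in> space M" for \<omega>
      using subprob_space_kernel[OF \<kappa>] that by auto
    have meas[measurable]: "(\<lambda>\<omega>. measure (\<kappa> \<omega>) A) \<in> borel_measurable M"
      using \<kappa> A measurable_compose[OF \<kappa> measurable_measure_subprob_algebra[OF A]] by simp
    have b: "\<bar>\<zeta> \<omega>\<bar> \<le> C" for \<omega> using \<zeta>(2,3)[of \<omega>] by simp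
    have C: "C \<ge> 0" using b[of undefined] by linarith
    have "emeasure (distr ?D N V) A = (\<integral>\<^sup>+\<omega>. ennreal (\<zeta> \<omega>) * indicator (V -` A \<inter> space M) \<omega> \<partial>M)"
      by (simp add: emeasure_distr emeasure_density)
    also have "\<dots> = (\<integral>\<^sup>+\<omega>. ennreal (\<zeta> \<omega> * indicator A (V \<omega>)) \<partial>M)"
      by (intro nn_integral_cong) (auto simp: indicator_def)
    also have "\<dots> = ennreal (\<integral>\<omega>. \<zeta> \<omega> * indicator A (V \<omega>) \<partial>M)"
      using b C \<zeta>(2) by (intro nn_integral_eq_integral integrable_const_bound[where B=C])
        (auto simp: indicator_def)
    also have "(\<integral>\<omega>. \<zeta> \<omega> * indicator A (V \<omega>) \<partial>M) = (\<integral>\<omega>. \<zeta> \<omega> * measure (\<kappa> \<omega>) A \<partial>M)"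
      by (rule cond_law_integral[OF M sub V law \<zeta>(1) b A meas])
    also have "ennreal \<dots> = (\<integral>\<^sup>+\<omega>. ennreal (\<zeta> \<omega> * measure (\<kappa> \<omega>) A) \<partial>M)"
    proof (intro nn_integral_eq_integral[symmetric] integrable_const_bound[where B=C] AE_I2)
      fix \<omega> assume "\<omega> \<in> space M"
      then have "measure (\<kappa> \<omega>) A \<le> 1" using sp subprob_space.subprob_measure_le_1 by blast
      then show "norm (\<zeta> \<omega> * measure (\<kappa> \<omega>) A) \<le> C"
        using mult_mono[OF b[of \<omega>], of "measure (\<kappa> \<omega>) A" 1] C by (simp add: abs_mult)
    qed (use \<zeta>(2) in auto)
    also have "\<dots> = (\<integral>\<^sup>+\<omega>. ennreal (\<zeta> \<omega>) * emeasure (\<kappa> \<omega>) A \<partial>M)"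
    proof (intro nn_integral_cong)
      fix \<omega> assume "\<omega> \<in> space M"
      then interpret subprob_space "\<kappa> \<omega>" by (rule sp)
      show "ennreal (\<zeta> \<omega> * measure (\<kappa> \<omega>) A) = ennreal (\<zeta> \<omega>) * emeasure (\<kappa> \<omega>) A"
        by (simp add: emeasure_eq_measure ennreal_mult \<zeta>(2))
    qed
    also have "\<dots> = (\<integral>\<^sup>+\<omega>. emeasure (\<kappa> \<omega>) A \<partial>?D)"
      by (subst nn_integral_density) auto
    also have "\<dots> = emeasure (?D \<bind> \<kappa>) A"
      using not_empty by (subst emeasure_bind[OF _ \<kappa>D A]) auto
    finally show "emeasure (distr ?D N V) A = emeasure (?D \<bind> \<kappa>) A" .
  qed
  then have "(\<integral>\<^sup>+v. g v \<partial>distr ?D N V) = (\<integral>\<^sup>+v. g v \<partial>(?D \<bind> \<kappa>))"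
    by simp
  then show ?thesis
    by (simp add: nn_integral_distr nn_integral_bind[OF g \<kappa>D] nn_integral_density)
qed

text \<open>
  The sets that do not separate \<open>\<omega>\<close> from \<open>\<omega>'\<close> form a sigma-algebra, and it contains the generators.
\<close>

lemma measurable_vimage_fibre:
  fixes g :: "'b \<Rightarrow> real"
  assumes "g \<in> borel_measurable (vimage_algebra \<Omega> f N)" "\<omega> \<in> \<Omega>" "\<omega>' \<in> \<Omega>" "f \<omega> = f \<omega>'"
  shows "g \<omega> = g \<omega>'"
proof -
  have "g -` {g \<omega>} \<inter> space (vimage_algebra \<Omega> f N) \<in> sets (vimage_algebra \<Omega> f N)"
    by (rule measurable_sets[OF assms(1)]) simp
  then have "g -` {g \<omega>} \<inter> \<Omega> \<in> sigma_sets \<Omega> {f -` A \<inter> \<Omega> | A. A \<in> sets N}"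
    unfolding sets_vimage_algebra space_vimage_algebra .
  moreover have "(\<omega> \<in> B) = (\<omega>' \<in> B)" if "B \<in> sigma_sets \<Omega> {f -` A \<inter> \<Omega> | A. A \<in> sets N}" for B
    using that
  proof (induction rule: sigma_sets.induct)
    case (Basic B)
    then obtain A where "B = f -` A \<inter> \<Omega>" by auto
    then show ?case using assms(2-4) by simp
  qed (use assms(2,3) in simp_all)
  ultimately have "\<omega> \<in> g -` {g \<omega>} \<inter> \<Omega> \<longleftrightarrow> \<omega>' \<in> g -` {g \<omega>} \<inter> \<Omega>"
    by blast
  then show ?thesis using assms(2,3) by simp
qed

section \<open>Almost sure limits of slowly varying sequences\<close>

text \<open>
  The expectation of the sum is finite by monotone convergence, so the sum is almost surely finite.  This
  turns second moment bounds into almost sure convergence.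
\<close>

lemma (in prob_space) AE_summable_of_expectation:
  fixes f :: "nat \<Rightarrow> 'a \<Rightarrow> real"
  assumes int: "\<And>n. integrable M (f n)" and nn: "\<And>n \<omega>. 0 \<le> f n \<omega>"
    and le: "\<And>n. expectation (f n) \<le> c n" and c: "summable c"
  shows "AE \<omega> in M. summable (\<lambda>n. f n \<omega>)"
proof -
  have [measurable]: "f n \<in> borel_measurable M" for n using int[of n] by auto
  have c0: "0 \<le> c n" for n
    by (rule order_trans[OF integral_nonneg_AE le]) (simp add: nn)
  have "(\<integral>\<^sup>+\<omega>. (\<Sum>n. ennreal (f n \<omega>)) \<partial>M) = (\<Sum>n. \<integral>\<^sup>+\<omega>. ennreal (f n \<omega>) \<partial>M)"
    by (intro nn_integral_suminf) measurable
  also have "\<dots> = (\<Sum>n. ennreal (expectation (f n)))"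
    using int nn by (simp add: nn_integral_eq_integral)
  also have "\<dots> \<le> (\<Sum>n. ennreal (c n))"
    using le by (intro suminf_le ennreal_leI) auto
  also have "\<dots> < \<infinity>"
    using c c0 by (simp add: suminf_ennreal2)
  finally have "(\<integral>\<^sup>+\<omega>. (\<Sum>n. ennreal (f n \<omega>)) \<partial>M) \<noteq> \<infinity>"
    by simp
  then have "AE \<omega> in M. (\<Sum>n. ennreal (f n \<omega>)) \<noteq> \<infinity>"
    by (intro nn_integral_PInf_AE) auto
  then show ?thesis
    by (rule eventually_mono) (use nn in \<open>auto intro: summable_suminf_not_top\<close>)
qed

lemma slow_variation_bound:
  fixes a :: "nat \<Rightarrow> real"
  assumes slow: "\<And>t. 1 \<le> t \<Longrightarrow> \<bar>a (Suc t) - a t\<bar> \<le> 1 / real t" and "1 \<le> s" "s \<le> t"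
  shows "\<bar>a t - a s\<bar> \<le> real (t - s) / real s"
  using \<open>s \<le> t\<close>
proof (induction t rule: dec_induct)
  case (step t)
  have "\<bar>a (Suc t) - a t\<bar> \<le> 1 / real s"
  proof (rule order_trans[OF slow])
    show "1 \<le> t" "1 / real t \<le> 1 / real s"
      using step.hyps \<open>1 \<le> s\<close> by (auto intro: frac_le)
  qed
  moreover have "\<bar>a (Suc t) - a s\<bar> \<le> \<bar>a (Suc t) - a t\<bar> + \<bar>a t - a s\<bar>" by linarith
  ultimately have "\<bar>a (Suc t) - a s\<bar> \<le> 1 / real s + real (t - s) / real s"
    using step.IH by linarith
  also have "\<dots> = real (Suc t - s) / real s"
    using step.hyps by (simp add: Suc_diff_le add_divide_distrib)
  finally show ?case .
qed simp

text \<open>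
  The gap between \<open>n ^ 4\<close> and \<open>(n + 1) ^ 4\<close> is at most \<open>15 * n ^ 3\<close>, and over it the sequence moves by at
  most \<open>15 / n\<close>.
\<close>

lemma slow_variation_limit:
  fixes a :: "nat \<Rightarrow> real"
  assumes slow: "\<And>t. 1 \<le> t \<Longrightarrow> \<bar>a (Suc t) - a t\<bar> \<le> 1 / real t"
    and lim: "(\<lambda>n. a (n ^ 4)) \<longlonglongrightarrow> L"
  shows "a \<longlonglongrightarrow> L"
proof -
  \<comment> \<open>the block of fourth powers that contains \<open>t\<close>\<close>
  define k where "k t = nat \<lfloor>root 4 (real t)\<rfloor>" for t
  have k_le: "k t ^ 4 \<le> t" and k_gt: "t < (k t + 1) ^ 4" for t
  proof -
    have r: "root 4 (real t) ^ 4 = real t" "0 \<le> root 4 (real t)" by auto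
    then have b: "real (k t) \<le> root 4 (real t)" "root 4 (real t) < real (k t + 1)"
      unfolding k_def by (auto simp: of_nat_nat) linarith+
    have "real (k t) ^ 4 \<le> root 4 (real t) ^ 4" "root 4 (real t) ^ 4 < real (k t + 1) ^ 4"
      by (rule power_mono[OF b(1)], simp, rule power_strict_mono[OF b(2)], simp_all)
    then show "k t ^ 4 \<le> t" "t < (k t + 1) ^ 4"
      unfolding r of_nat_power[symmetric] of_nat_le_iff of_nat_less_iff by blast+
  qed
  have k_top: "filterlim k at_top sequentially"
    unfolding filterlim_at_top
  proof
    fix K
    show "\<forall>\<^sub>F t in sequentially. K \<le> k t"
      using eventually_ge_at_top[of "K ^ 4"]
    proof eventually_elim
      case (elim t)
      then have "K ^ 4 < (k t + 1) ^ 4" using k_gt[of t] by linarith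
      then have "K < k t + 1" by (rule power_less_imp_less_base) simp
      then show ?case by simp
    qed
  qed
  have "(\<lambda>t. a t - a (k t ^ 4)) \<longlonglongrightarrow> 0"
  proof (rule Lim_null_comparison)
    have "\<forall>\<^sub>F t in sequentially. 1 \<le> k t"
      using k_top by (simp add: filterlim_at_top)
    then show "\<forall>\<^sub>F t in sequentially. norm (a t - a (k t ^ 4)) \<le> 15 / real (k t)"
    proof eventually_elim
      case (elim t)
      then have k: "1 \<le> real (k t)" by simp
      have "\<bar>a t - a (k t ^ 4)\<bar> \<le> real (t - k t ^ 4) / real (k t ^ 4)"
        using elim k_le[of t] by (intro slow_variation_bound slow) auto
      also have "real (t - k t ^ 4) \<le> 15 * real (k t) ^ 3"
      proof -
        have "real (t - k t ^ 4) = real t - real (k t) ^ 4"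
          using k_le[of t] by (simp add: of_nat_diff)
        also have "\<dots> \<le> (real (k t) + 1) ^ 4 - real (k t) ^ 4"
        proof -
          have "real t \<le> real ((k t + 1) ^ 4)"
            using k_gt[of t] by (simp only: of_nat_le_iff less_imp_le)
          then show ?thesis by (simp add: add.commute)
        qed
        also have "\<dots> = 4 * real (k t) ^ 3 + 6 * real (k t) ^ 2 + 4 * real (k t) + 1"
          by (simp add: power2_eq_square power3_eq_cube power4_eq_xxxx algebra_simps)
        also have "\<dots> \<le> 15 * real (k t) ^ 3"
        proof -
          have "real (k t) ^ 2 \<le> real (k t) ^ 3" by (rule power_increasing[OF _ k]) simp
          moreover have "real (k t) \<le> real (k t) ^ 3" by (rule self_le_power[OF k]) simp
          moreover have "1 \<le> real (k t) ^ 3" by (rule one_le_power[OF k])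
          ultimately show ?thesis by linarith
        qed
        finally show ?thesis .
      qed
      then have "real (t - k t ^ 4) / real (k t ^ 4) \<le> 15 * real (k t) ^ 3 / real (k t) ^ 4"
        by (simp add: divide_right_mono)
      also have "\<dots> = 15 / real (k t)"
        using k by (simp add: power4_eq_xxxx power3_eq_cube)
      finally show ?case by simp
    qed
    have "(\<lambda>n. 15 / real n) \<longlonglongrightarrow> 0" by real_asymp
    from filterlim_compose[OF this k_top] show "(\<lambda>t. 15 / real (k t)) \<longlonglongrightarrow> 0" .
  qed
  moreover have "(\<lambda>t. a (k t ^ 4)) \<longlonglongrightarrow> L"
    using filterlim_compose[OF lim k_top] .
  ultimately show ?thesis
    using tendsto_add by fastforce
qed

section \<open>Conditional law of the messages\<close>

context misspecified_bernoulli_sampling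
begin

abbreviation \<F> :: "nat \<Rightarrow> 'a measure" where "\<F> t \<equiv> past M \<theta> S Y X t"

lemma past_generators_subset:
  "preimages M borel \<theta> \<union> (\<Union>i. preimages M (count_space UNIV) (S i)) \<union>
    (\<Union>i. \<Union>s\<in>{1..<t}. preimages M borel (Y i s) \<union> preimages M (count_space UNIV) (X i s)) \<subseteq> sets M"
  using measurable_state measurable_signal measurable_sample measurable_message
  by (intro Un_least UN_least preimages_subset_sets) auto

lemma subalgebra_past: "subalgebra M (\<F> t)"
  unfolding past_def by (rule subalgebra_sigma[OF past_generators_subset])

lemma subalgebra_past_and_samples:
  assumes "1 \<le> t" shows "subalgebra M (past_and_samples M \<theta> S Y X t)"
  unfolding past_and_samples_def using subalgebra_past[of t] assms
  by (intro subalgebra_sigma Un_least UN_least preimages_subset_sets measurable_sample)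
     (auto simp: subalgebra_def)

lemma space_past [simp]: "space (\<F> t) = space M"
  using subalgebra_past by (simp add: subalgebra_def)

lemma sets_past_mono:
  assumes "s \<le> t" shows "sets (\<F> s) \<subseteq> sets (\<F> t)"
proof -
  let ?G = "\<lambda>t. preimages M borel \<theta> \<union> (\<Union>i. preimages M (count_space UNIV) (S i)) \<union>
    (\<Union>i. \<Union>s\<in>{1..<t}. preimages M borel (Y i s) \<union> preimages M (count_space UNIV) (X i s))"
  have "?G s \<subseteq> ?G t"
    using assms by (intro Un_mono UN_mono order_refl) auto
  moreover have "?G t \<subseteq> Pow (space M)" for t
    using past_generators_subset sets.space_closed by (rule order_trans)
  ultimately show ?thesis
    unfolding past_def by (simp only: sets_measure_of sigma_sets_mono')
qed

lemma past_mono_measurable: "f \<in> measurable (\<F> s) N \<Longrightarrow> s \<le> t \<Longrightarrow> f \<in> measurable (\<F> t) N"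
  by (rule measurable_from_subalg[rotated]) (auto simp: subalgebra_def dest: subsetD[OF sets_past_mono])

lemma past_measurable: "f \<in> measurable (\<F> t) N \<Longrightarrow> f \<in> measurable M N"
  by (rule measurable_from_subalg[OF subalgebra_past])

lemma past_measurable_past_and_samples:
  assumes "f \<in> measurable (\<F> t) N" "1 \<le> t"
  shows "f \<in> measurable (past_and_samples M \<theta> S Y X t) N"
proof (rule measurable_from_subalg[OF _ assms(1)])
  let ?G = "sets (\<F> t) \<union> (\<Union>i. preimages M borel (Y i t))"
  have "?G \<subseteq> Pow (space M)"
    using preimages_subset_sets[OF measurable_sample[OF assms(2)]] subalgebra_past[of t] sets.space_closed[of M]
    unfolding subalgebra_def by blast
  then show "subalgebra (past_and_samples M \<theta> S Y X t) (\<F> t)"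
    by (auto simp: subalgebra_def past_and_samples_def)
qed

lemma signal_past_measurable: "S i \<in> measurable (\<F> t) (count_space UNIV)"
  unfolding past_def using past_generators_subset measurable_signal
  by (intro measurable_sigma_preimages) auto

lemma message_past_measurable:
  "1 \<le> s \<Longrightarrow> s < t \<Longrightarrow> X i s \<in> measurable (\<F> t) (count_space UNIV)"
  unfolding past_def using past_generators_subset measurable_message
  by (intro measurable_sigma_preimages) auto

definition obs :: "agent \<Rightarrow> nat \<Rightarrow> 'a \<Rightarrow> bool list" where
  "obs i t \<omega> = S i \<omega> # map (\<lambda>s. X (other i) s \<omega>) [1..<t]"

lemma misspec_posterior_obs: "misspec_posterior S X i t \<omega> = bernoulli_posterior (obs i t \<omega>)"
  by (simp add: misspec_posterior_def obs_def)

lemma length_obs: "1 \<le> t \<Longrightarrow> length (obs i t \<omega>) = t"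
  by (simp add: obs_def)

lemma obs_Suc: "1 \<le> t \<Longrightarrow> obs i (Suc t) \<omega> = obs i t \<omega> @ [X (other i) t \<omega>]"
  by (simp add: obs_def)

lemma obs_past_measurable: "obs i t \<in> measurable (\<F> t) (count_space UNIV)"
proof (induction t)
  case 0
  have "(\<lambda>b. [b]) \<circ> S i \<in> measurable (\<F> 0) (count_space UNIV)"
    by (rule measurable_comp[OF signal_past_measurable]) simp
  then show ?case by (simp add: obs_def comp_def)
next
  case (Suc t)
  show ?case
  proof (cases "1 \<le> t")
    case True
    have "(\<lambda>\<omega>. (\<lambda>xs \<omega>. xs @ [X (other i) t \<omega>]) (obs i t \<omega>) \<omega>) \<in> measurable (\<F> (Suc t)) (count_space UNIV)"
    proof (rule measurable_compose_countable[where g = "obs i t"])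
      show "obs i t \<in> measurable (\<F> (Suc t)) (count_space UNIV)"
        using Suc.IH by (rule past_mono_measurable) simp
      fix xs :: "bool list"
      have "(\<lambda>b. xs @ [b]) \<circ> X (other i) t \<in> measurable (\<F> (Suc t)) (count_space UNIV)"
        using True by (intro measurable_comp[OF message_past_measurable]) auto
      then show "(\<lambda>\<omega>. xs @ [X (other i) t \<omega>]) \<in> measurable (\<F> (Suc t)) (count_space UNIV)"
        by (simp add: comp_def)
    qed
    then show ?thesis by (simp add: obs_Suc[OF True] cong: measurable_cong)
  next
    case False
    have "(\<lambda>b. [b]) \<circ> S i \<in> measurable (\<F> (Suc t)) (count_space UNIV)"
      by (rule measurable_comp[OF signal_past_measurable]) simp
    then show ?thesis using False by (simp add: obs_def comp_def)
  qed
qed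

definition pmean :: "agent \<Rightarrow> nat \<Rightarrow> 'a \<Rightarrow> real" where
  "pmean i t \<omega> = post_mean (obs i t \<omega>)"

definition msg :: "agent \<Rightarrow> nat \<Rightarrow> 'a \<Rightarrow> real" where
  "msg i t \<omega> = of_bool (X i t \<omega>)"

lemma pmean_past_measurable: "pmean i t \<in> borel_measurable (\<F> t)"
proof -
  have "post_mean \<circ> obs i t \<in> borel_measurable (\<F> t)"
    by (rule measurable_comp[OF obs_past_measurable]) simp
  then show ?thesis by (simp add: pmean_def[abs_def] comp_def)
qed

lemma pmean_bounds: "0 < pmean i t \<omega>" "pmean i t \<omega> < 1"
  by (auto simp: pmean_def post_mean_bounds)

lemma msg_bounds: "0 \<le> msg i t \<omega>" "msg i t \<omega> \<le> 1"
  by (auto simp: msg_def)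

lemma msg_square: "msg i t \<omega> ^ 2 = msg i t \<omega>"
  by (auto simp: msg_def)

lemma msg_measurable: "1 \<le> t \<Longrightarrow> msg i t \<in> borel_measurable M"
  unfolding msg_def[abs_def] by (rule measurable_compose[OF measurable_message]) auto

lemma pmean_Suc:
  assumes "1 \<le> t"
  shows "pmean i (Suc t) \<omega> = ((real t + 2) * pmean i t \<omega> + msg (other i) t \<omega>) / (real t + 3)"
  using assms
  by (simp add: pmean_def msg_def post_mean_def obs_Suc length_obs add_ac)

text \<open>
  The kernel takes countably many values, because it is a function of the two lists of observed bits.
\<close>

lemma sample_kernel_measurable:
  "(\<lambda>\<omega>. misspec_posterior S X Agent1 t \<omega> \<Otimes>\<^sub>M misspec_posterior S X Agent2 t \<omega>)
     \<in> measurable M (subprob_algebra (borel \<Otimes>\<^sub>M borel))"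
proof -
  have "(\<lambda>\<omega>. (obs Agent1 t \<omega>, obs Agent2 t \<omega>)) \<in> measurable M (count_space UNIV \<Otimes>\<^sub>M count_space UNIV)"
    by (intro measurable_Pair past_measurable[OF obs_past_measurable])
  then have 1: "(\<lambda>\<omega>. (obs Agent1 t \<omega>, obs Agent2 t \<omega>)) \<in> measurable M (count_space UNIV)"
    by (simp add: pair_measure_countable)
  have 2: "(\<lambda>(as, bs). bernoulli_posterior as \<Otimes>\<^sub>M bernoulli_posterior bs) \<in>
      measurable (count_space UNIV) (subprob_algebra (borel \<Otimes>\<^sub>M borel))"
  proof (rule measurable_count_space_eq1[THEN iffD2], safe)
    fix as bs
    interpret a: prob_space "bernoulli_posterior as" by (rule prob_space_bernoulli_posterior)
    interpret b: prob_space "bernoulli_posterior bs" by (rule prob_space_bernoulli_posterior)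
    interpret pair_prob_space "bernoulli_posterior as" "bernoulli_posterior bs" ..
    show "bernoulli_posterior as \<Otimes>\<^sub>M bernoulli_posterior bs \<in> space (subprob_algebra (borel \<Otimes>\<^sub>M borel))"
      by (auto simp: space_subprob_algebra sets_bernoulli_posterior
          intro!: prob_space_imp_subprob_space P.prob_space_axioms sets_pair_measure_cong)
  qed
  show ?thesis
    using measurable_comp[OF 1 2] by (simp add: comp_def misspec_posterior_obs)
qed

abbreviation clamp :: "real \<Rightarrow> real" where "clamp y \<equiv> min 1 (max 0 y)"

lemma nn_integral_sample_kernel:
  fixes t \<omega>
  defines "P \<equiv> misspec_posterior S X Agent1 t \<omega> \<Otimes>\<^sub>M misspec_posterior S X Agent2 t \<omega>"
  shows "(\<integral>\<^sup>+y. ennreal (clamp (fst y)) \<partial>P) = ennreal (pmean Agent1 t \<omega>)"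
    and "(\<integral>\<^sup>+y. ennreal (clamp (snd y)) \<partial>P) = ennreal (pmean Agent2 t \<omega>)"
    and "(\<integral>\<^sup>+y. ennreal (clamp (fst y) * clamp (snd y)) \<partial>P) = ennreal (pmean Agent1 t \<omega> * pmean Agent2 t \<omega>)"
proof -
  let ?P1 = "bernoulli_posterior (obs Agent1 t \<omega>)" and ?P2 = "bernoulli_posterior (obs Agent2 t \<omega>)"
  interpret a: prob_space ?P1 by (rule prob_space_bernoulli_posterior)
  interpret b: prob_space ?P2 by (rule prob_space_bernoulli_posterior)
  interpret pair_prob_space ?P1 ?P2 ..
  note [measurable_cong] = sets_bernoulli_posterior
  have P: "P = ?P1 \<Otimes>\<^sub>M ?P2" by (simp add: P_def misspec_posterior_obs)
  have prod: "(\<integral>\<^sup>+y. ennreal (f (fst y) * g (snd y)) \<partial>P) = (\<integral>\<^sup>+u. ennreal (f u) \<partial>?P1) * (\<integral>\<^sup>+v. ennreal (g v) \<partial>?P2)"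
    if [measurable]: "f \<in> borel_measurable borel" "g \<in> borel_measurable borel"
      and nn: "\<And>u. 0 \<le> f u" "\<And>u. 0 \<le> g u" for f g :: "real \<Rightarrow> real"
  proof -
    have "(\<integral>\<^sup>+y. ennreal (f (fst y) * g (snd y)) \<partial>P) = (\<integral>\<^sup>+u. \<integral>\<^sup>+v. ennreal (f u * g v) \<partial>?P2 \<partial>?P1)"
      unfolding P by (subst b.nn_integral_fst[symmetric]) auto
    also have "\<dots> = (\<integral>\<^sup>+u. ennreal (f u) * (\<integral>\<^sup>+v. ennreal (g v) \<partial>?P2) \<partial>?P1)"
      using nn by (auto simp: ennreal_mult nn_integral_cmult)
    also have "\<dots> = (\<integral>\<^sup>+u. ennreal (f u) \<partial>?P1) * (\<integral>\<^sup>+v. ennreal (g v) \<partial>?P2)"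
      by (subst nn_integral_multc) auto
    finally show ?thesis .
  qed
  have one: "(\<integral>\<^sup>+u. ennreal 1 \<partial>?P1) = 1" "(\<integral>\<^sup>+u. ennreal 1 \<partial>?P2) = 1"
    using a.emeasure_space_1 b.emeasure_space_1 by simp_all
  show "(\<integral>\<^sup>+y. ennreal (clamp (fst y)) \<partial>P) = ennreal (pmean Agent1 t \<omega>)"
    using prod[of clamp "\<lambda>_. 1"] one by (simp add: nn_integral_bernoulli_posterior_mean pmean_def)
  show "(\<integral>\<^sup>+y. ennreal (clamp (snd y)) \<partial>P) = ennreal (pmean Agent2 t \<omega>)"
    using prod[of "\<lambda>_. 1" clamp] one by (simp add: nn_integral_bernoulli_posterior_mean pmean_def)
  show "(\<integral>\<^sup>+y. ennreal (clamp (fst y) * clamp (snd y)) \<partial>P) = ennreal (pmean Agent1 t \<omega> * pmean Agent2 t \<omega>)"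
    using prod[of clamp clamp] by (simp add: nn_integral_bernoulli_posterior_mean pmean_def ennreal_mult post_mean_bounds less_imp_le)
qed

lemma integrable_bounded:
  fixes f :: "'a \<Rightarrow> real"
  assumes "f \<in> borel_measurable M" "\<And>\<omega>. \<bar>f \<omega>\<bar> \<le> C"
  shows "integrable M f"
  using assms by (intro integrable_const_bound[where B=C]) auto

text \<open>
  Integrates out the posterior samples of time \<open>t\<close>: a bounded function \<open>g\<close> of the two samples may be
  replaced by its average \<open>G\<close> under the product of the two posteriors.
\<close>

lemma sample_expectation:
  assumes t: "1 \<le> t" and \<zeta>: "\<zeta> \<in> borel_measurable (\<F> t)" "\<And>\<omega>. 0 \<le> \<zeta> \<omega>" "\<And>\<omega>. \<zeta> \<omega> \<le> C"
    and g: "g \<in> borel_measurable (borel \<Otimes>\<^sub>M borel)" "\<And>y. 0 \<le> g y" "\<And>y. g y \<le> 1"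
    and G: "G \<in> borel_measurable M" "\<And>\<omega>. 0 \<le> G \<omega>" "\<And>\<omega>. G \<omega> \<le> 1"
    and eq: "\<And>\<omega>. (\<integral>\<^sup>+y. ennreal (g y) \<partial>(misspec_posterior S X Agent1 t \<omega> \<Otimes>\<^sub>M misspec_posterior S X Agent2 t \<omega>)) = ennreal (G \<omega>)"
  shows "(\<integral>\<omega>. \<zeta> \<omega> * g (Y Agent1 t \<omega>, Y Agent2 t \<omega>) \<partial>M) = (\<integral>\<omega>. \<zeta> \<omega> * G \<omega> \<partial>M)"
proof -
  note [measurable] = measurable_sample[OF t] past_measurable[OF \<zeta>(1)] g(1) G(1)
  have V[measurable]: "(\<lambda>\<omega>. (Y Agent1 t \<omega>, Y Agent2 t \<omega>)) \<in> measurable M (borel \<Otimes>\<^sub>M borel)"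
    by measurable
  have C: "C \<ge> 0" using \<zeta>(2,3)[of undefined] by linarith
  have bound: "\<zeta> \<omega> * h \<le> C" if "0 \<le> h" "h \<le> 1" for h \<omega>
    using mult_mono[OF \<zeta>(3)[of \<omega>], of h 1] that \<zeta>(2) C by simp
  have "ennreal (\<integral>\<omega>. \<zeta> \<omega> * g (Y Agent1 t \<omega>, Y Agent2 t \<omega>) \<partial>M) =
     (\<integral>\<^sup>+\<omega>. ennreal (\<zeta> \<omega> * g (Y Agent1 t \<omega>, Y Agent2 t \<omega>)) \<partial>M)"
    using \<zeta> g C bound by (intro nn_integral_eq_integral[symmetric] integrable_bounded[where C=C]) auto
  also have "\<dots> = (\<integral>\<^sup>+\<omega>. ennreal (\<zeta> \<omega>) * ennreal (g (Y Agent1 t \<omega>, Y Agent2 t \<omega>)) \<partial>M)"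
    using \<zeta> g by (simp add: ennreal_mult)
  also have "\<dots> = (\<integral>\<^sup>+\<omega>. ennreal (\<zeta> \<omega>) * ennreal (G \<omega>) \<partial>M)"
    unfolding eq[symmetric]
    by (rule cond_law_nn_integral[OF prob_space_axioms subalgebra_past V samples[OF t]
          sample_kernel_measurable \<zeta>]) measurable
  also have "\<dots> = (\<integral>\<^sup>+\<omega>. ennreal (\<zeta> \<omega> * G \<omega>) \<partial>M)"
    using \<zeta> G by (simp add: ennreal_mult)
  also have "\<dots> = ennreal (\<integral>\<omega>. \<zeta> \<omega> * G \<omega> \<partial>M)"
    using \<zeta> G C bound by (intro nn_integral_eq_integral integrable_bounded[where C=C]) auto
  finally show ?thesis
    using \<zeta> g G by (subst (asm) ennreal_inj) (auto intro!: integral_nonneg_AE)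
qed

text \<open>
  Tower property in two stages: given the samples, the messages are independent Bernoulli variables whose
  parameters are the samples; given the past, the samples are independent with means \<^term>\<open>pmean Agent1 t\<close>
  and \<^term>\<open>pmean Agent2 t\<close>.
\<close>

lemma message_expectation_nonneg:
  assumes t: "1 \<le> t" and \<zeta>: "\<zeta> \<in> borel_measurable (\<F> t)" "\<And>\<omega>. 0 \<le> \<zeta> \<omega>" "\<And>\<omega>. \<zeta> \<omega> \<le> C"
  shows "(\<integral>\<omega>. \<zeta> \<omega> * msg i t \<omega> \<partial>M) = (\<integral>\<omega>. \<zeta> \<omega> * pmean i t \<omega> \<partial>M)"
    and "(\<integral>\<omega>. \<zeta> \<omega> * (msg Agent1 t \<omega> * msg Agent2 t \<omega>) \<partial>M) = (\<integral>\<omega>. \<zeta> \<omega> * (pmean Agent1 t \<omega> * pmean Agent2 t \<omega>) \<partial>M)"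
proof -
  note [measurable] = measurable_sample[OF t] past_measurable[OF \<zeta>(1)] measurable_message[OF t]
    past_measurable[OF pmean_past_measurable]
  let ?K = "\<lambda>\<omega>. pair_pmf (bernoulli_pmf (Y Agent1 t \<omega>)) (bernoulli_pmf (Y Agent2 t \<omega>))"
  have V: "(\<lambda>\<omega>. (X Agent1 t \<omega>, X Agent2 t \<omega>)) \<in> measurable M (count_space UNIV)"
  proof -
    have "(\<lambda>\<omega>. (X Agent1 t \<omega>, X Agent2 t \<omega>)) \<in> measurable M (count_space UNIV \<Otimes>\<^sub>M count_space UNIV)"
      by measurable
    then show ?thesis by (simp add: pair_measure_countable)
  qed
  have b: "\<bar>\<zeta> \<omega>\<bar> \<le> C" for \<omega> using \<zeta>(2,3)[of \<omega>] by simp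
  have msg: "(\<integral>\<omega>. \<zeta> \<omega> * indicator A (X Agent1 t \<omega>, X Agent2 t \<omega>) \<partial>M) = (\<integral>\<omega>. \<zeta> \<omega> * g (Y Agent1 t \<omega>, Y Agent2 t \<omega>) \<partial>M)"
    if "\<And>\<omega>. measure (measure_pmf (?K \<omega>)) A = g (Y Agent1 t \<omega>, Y Agent2 t \<omega>)" "g \<in> borel_measurable (borel \<Otimes>\<^sub>M borel)"
    for A and g :: "real \<times> real \<Rightarrow> real"
    unfolding that(1)[symmetric]
    by (rule cond_law_integral[OF prob_space_axioms subalgebra_past_and_samples[OF t] V messages[OF t]
          past_measurable_past_and_samples[OF \<zeta>(1) t] b])
       (use that(2) in \<open>simp_all add: that(1)\<close>)
  have m1: "measure (measure_pmf (pair_pmf p q)) {z. fst z} = pmf p True" for p q :: "bool pmf"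
  proof -
    have "measure (measure_pmf (pair_pmf p q)) {z. fst z} = measure (map_pmf fst (pair_pmf p q)) {True}"
      by (simp add: vimage_def)
    then show ?thesis by (simp add: map_fst_pair_pmf measure_pmf_single)
  qed
  have m2: "measure (measure_pmf (pair_pmf p q)) {z. snd z} = pmf q True" for p q :: "bool pmf"
  proof -
    have "measure (measure_pmf (pair_pmf p q)) {z. snd z} = measure (map_pmf snd (pair_pmf p q)) {True}"
      by (simp add: vimage_def)
    then show ?thesis by (simp add: map_snd_pair_pmf measure_pmf_single)
  qed
  have "(\<integral>\<omega>. \<zeta> \<omega> * msg Agent1 t \<omega> \<partial>M) = (\<integral>\<omega>. \<zeta> \<omega> * indicator {z. fst z} (X Agent1 t \<omega>, X Agent2 t \<omega>) \<partial>M)"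
    by (simp add: msg_def indicator_def)
  also have "\<dots> = (\<integral>\<omega>. \<zeta> \<omega> * clamp (fst (Y Agent1 t \<omega>, Y Agent2 t \<omega>)) \<partial>M)"
    by (rule msg) (simp_all add: m1 pmf_bernoulli_clamp)
  also have "\<dots> = (\<integral>\<omega>. \<zeta> \<omega> * pmean Agent1 t \<omega> \<partial>M)"
    by (rule sample_expectation[OF t \<zeta>]) (auto simp: nn_integral_sample_kernel pmean_bounds less_imp_le)
  finally have 1: "(\<integral>\<omega>. \<zeta> \<omega> * msg Agent1 t \<omega> \<partial>M) = (\<integral>\<omega>. \<zeta> \<omega> * pmean Agent1 t \<omega> \<partial>M)" .
  have "(\<integral>\<omega>. \<zeta> \<omega> * msg Agent2 t \<omega> \<partial>M) = (\<integral>\<omega>. \<zeta> \<omega> * indicator {z. snd z} (X Agent1 t \<omega>, X Agent2 t \<omega>) \<partial>M)"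
    by (simp add: msg_def indicator_def)
  also have "\<dots> = (\<integral>\<omega>. \<zeta> \<omega> * clamp (snd (Y Agent1 t \<omega>, Y Agent2 t \<omega>)) \<partial>M)"
    by (rule msg) (simp_all add: m2 pmf_bernoulli_clamp)
  also have "\<dots> = (\<integral>\<omega>. \<zeta> \<omega> * pmean Agent2 t \<omega> \<partial>M)"
    by (rule sample_expectation[OF t \<zeta>]) (auto simp: nn_integral_sample_kernel pmean_bounds less_imp_le)
  finally have 2: "(\<integral>\<omega>. \<zeta> \<omega> * msg Agent2 t \<omega> \<partial>M) = (\<integral>\<omega>. \<zeta> \<omega> * pmean Agent2 t \<omega> \<partial>M)" .
  show "(\<integral>\<omega>. \<zeta> \<omega> * msg i t \<omega> \<partial>M) = (\<integral>\<omega>. \<zeta> \<omega> * pmean i t \<omega> \<partial>M)"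
    using 1 2 by (cases i) auto
  have "(\<integral>\<omega>. \<zeta> \<omega> * (msg Agent1 t \<omega> * msg Agent2 t \<omega>) \<partial>M) = (\<integral>\<omega>. \<zeta> \<omega> * indicator {(True, True)} (X Agent1 t \<omega>, X Agent2 t \<omega>) \<partial>M)"
    by (intro Bochner_Integration.integral_cong) (auto simp: msg_def indicator_def)
  also have "\<dots> = (\<integral>\<omega>. \<zeta> \<omega> * (\<lambda>y. clamp (fst y) * clamp (snd y)) (Y Agent1 t \<omega>, Y Agent2 t \<omega>) \<partial>M)"
    by (rule msg) (simp_all add: measure_pmf_single pmf_pair pmf_bernoulli_clamp)
  also have "\<dots> = (\<integral>\<omega>. \<zeta> \<omega> * (pmean Agent1 t \<omega> * pmean Agent2 t \<omega>) \<partial>M)"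
    by (rule sample_expectation[OF t \<zeta>])
       (auto simp: nn_integral_sample_kernel pmean_bounds less_imp_le intro!: mult_le_one)
  finally show "(\<integral>\<omega>. \<zeta> \<omega> * (msg Agent1 t \<omega> * msg Agent2 t \<omega>) \<partial>M) = (\<integral>\<omega>. \<zeta> \<omega> * (pmean Agent1 t \<omega> * pmean Agent2 t \<omega>) \<partial>M)" .
qed

text \<open>
  Passes to weights of arbitrary sign by adding the constant \<open>C\<close>.
\<close>

lemma message_expectation:
  assumes t: "1 \<le> t" and \<zeta>: "\<zeta> \<in> borel_measurable (\<F> t)" "\<And>\<omega>. \<bar>\<zeta> \<omega>\<bar> \<le> C"
  shows "(\<integral>\<omega>. \<zeta> \<omega> * msg i t \<omega> \<partial>M) = (\<integral>\<omega>. \<zeta> \<omega> * pmean i t \<omega> \<partial>M)"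
    and "(\<integral>\<omega>. \<zeta> \<omega> * (msg Agent1 t \<omega> * msg Agent2 t \<omega>) \<partial>M) = (\<integral>\<omega>. \<zeta> \<omega> * (pmean Agent1 t \<omega> * pmean Agent2 t \<omega>) \<partial>M)"
proof -
  note [measurable] = past_measurable[OF \<zeta>(1)] msg_measurable[OF t] past_measurable[OF pmean_past_measurable]
  have C: "C \<ge> 0" using \<zeta>(2)[of undefined] by linarith
  have nn: "(\<lambda>\<omega>. \<zeta> \<omega> + C) \<in> borel_measurable (\<F> t)" "\<And>\<omega>. 0 \<le> \<zeta> \<omega> + C" "\<And>\<omega>. \<zeta> \<omega> + C \<le> 2 * C"
    and cc: "(\<lambda>\<omega>. C) \<in> borel_measurable (\<F> t)" "\<And>\<omega>::'a. 0 \<le> C" "\<And>\<omega>::'a. C \<le> C"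
    using \<zeta> C by (auto simp: abs_le_iff) (smt (verit) abs_le_D1 abs_le_D2)+
  have shift: "(\<integral>\<omega>. \<zeta> \<omega> * u \<omega> \<partial>M) = (\<integral>\<omega>. \<zeta> \<omega> * v \<omega> \<partial>M)"
    if "(\<integral>\<omega>. (\<zeta> \<omega> + C) * u \<omega> \<partial>M) = (\<integral>\<omega>. (\<zeta> \<omega> + C) * v \<omega> \<partial>M)" "(\<integral>\<omega>. C * u \<omega> \<partial>M) = (\<integral>\<omega>. C * v \<omega> \<partial>M)"
      and [measurable]: "u \<in> borel_measurable M" "v \<in> borel_measurable M"
      and "\<And>\<omega>. \<bar>u \<omega>\<bar> \<le> 1" "\<And>\<omega>. \<bar>v \<omega>\<bar> \<le> 1" for u v
  proof -
    have int: "integrable M (\<lambda>\<omega>. \<zeta> \<omega> * w \<omega>)" "integrable M (\<lambda>\<omega>. C * w \<omega>)"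
      if [measurable]: "w \<in> borel_measurable M" and w: "\<And>\<omega>. \<bar>w \<omega>\<bar> \<le> 1" for w
    proof -
      have "\<bar>\<zeta> \<omega> * w \<omega>\<bar> \<le> C" for \<omega>
        using mult_mono[OF \<zeta>(2)[of \<omega>] w[of \<omega>]] C by (simp add: abs_mult)
      then show "integrable M (\<lambda>\<omega>. \<zeta> \<omega> * w \<omega>)"
        by (rule integrable_bounded[rotated]) measurable
      show "integrable M (\<lambda>\<omega>. C * w \<omega>)"
        using w by (intro integrable_mult_right integrable_bounded[where C=1]) auto
    qed
    show ?thesis
      using that int[of u] int[of v] by (auto simp: distrib_right)
  qed
  show "(\<integral>\<omega>. \<zeta> \<omega> * msg i t \<omega> \<partial>M) = (\<integral>\<omega>. \<zeta> \<omega> * pmean i t \<omega> \<partial>M)"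
    by (rule shift[OF message_expectation_nonneg(1)[OF t nn] message_expectation_nonneg(1)[OF t cc]])
       (auto simp: abs_le_iff msg_bounds pmean_bounds less_imp_le intro: order_trans[of _ 0])
  have "\<bar>msg Agent1 t \<omega> * msg Agent2 t \<omega>\<bar> \<le> 1" "\<bar>pmean Agent1 t \<omega> * pmean Agent2 t \<omega>\<bar> \<le> 1" for \<omega>
    by (auto simp: abs_mult msg_bounds pmean_bounds less_imp_le intro!: mult_le_one)
  then show "(\<integral>\<omega>. \<zeta> \<omega> * (msg Agent1 t \<omega> * msg Agent2 t \<omega>) \<partial>M) = (\<integral>\<omega>. \<zeta> \<omega> * (pmean Agent1 t \<omega> * pmean Agent2 t \<omega>) \<partial>M)"
    by (intro shift[OF message_expectation_nonneg(2)[OF t nn] message_expectation_nonneg(2)[OF t cc]]) auto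
qed

section \<open>Convergence of the posterior means\<close>

text \<open>
  The admissible weights: bounded random variables known at time \<open>t\<close>.  An identity or inequality that
  holds for the expectation against all such weights (nonnegative ones in the case of an inequality) is
  one between conditional expectations given the past.  The class is closed under the algebraic
  operations, and all its members are integrable.
\<close>

definition past_bounded :: "nat \<Rightarrow> ('a \<Rightarrow> real) \<Rightarrow> bool" where
  "past_bounded t f \<longleftrightarrow> f \<in> borel_measurable (\<F> t) \<and> (\<exists>C. \<forall>\<omega>. \<bar>f \<omega>\<bar> \<le> C)"

named_theorems bdd

lemma past_bounded_const [bdd]: "past_bounded t (\<lambda>\<omega>. c)"
  by (auto simp: past_bounded_def)

lemma past_bounded_add [bdd]:
  assumes "past_bounded t f" "past_bounded t g" shows "past_bounded t (\<lambda>\<omega>. f \<omega> + g \<omega>)"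
proof -
  from assms obtain C D where "\<And>\<omega>. \<bar>f \<omega>\<bar> \<le> C" "\<And>\<omega>. \<bar>g \<omega>\<bar> \<le> D" unfolding past_bounded_def by blast
  then have "\<bar>f \<omega> + g \<omega>\<bar> \<le> C + D" for \<omega>
    using abs_triangle_ineq[of "f \<omega>" "g \<omega>"] by (smt (verit))
  then show ?thesis using assms unfolding past_bounded_def by auto
qed

lemma past_bounded_mult [bdd]:
  assumes "past_bounded t f" "past_bounded t g" shows "past_bounded t (\<lambda>\<omega>. f \<omega> * g \<omega>)"
proof -
  from assms obtain C D where "\<And>\<omega>. \<bar>f \<omega>\<bar> \<le> C" "\<And>\<omega>. \<bar>g \<omega>\<bar> \<le> D" unfolding past_bounded_def by blast
  then have "\<bar>f \<omega> * g \<omega>\<bar> \<le> C * D" for \<omega>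
    unfolding abs_mult by (intro mult_mono) (auto intro: order_trans[OF abs_ge_zero])
  then show ?thesis using assms unfolding past_bounded_def by auto
qed

lemma past_bounded_diff [bdd]:
  assumes "past_bounded t f" "past_bounded t g" shows "past_bounded t (\<lambda>\<omega>. f \<omega> - g \<omega>)"
  using past_bounded_add[OF assms(1) past_bounded_mult[OF past_bounded_const[of t "-1"] assms(2)]] by simp

lemma past_bounded_divide [bdd]:
  assumes "past_bounded t f" shows "past_bounded t (\<lambda>\<omega>. f \<omega> / c)"
  using past_bounded_mult[OF assms past_bounded_const[of t "1 / c"]] by simp

lemma past_bounded_power [bdd]:
  assumes "past_bounded t f" shows "past_bounded t (\<lambda>\<omega>. f \<omega> ^ n)"
  by (induction n) (auto intro: bdd assms)

lemma past_bounded_mono: "past_bounded s f \<Longrightarrow> s \<le> t \<Longrightarrow> past_bounded t f"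
  by (auto simp: past_bounded_def intro: past_mono_measurable)

lemma past_bounded_pmean [bdd]: "past_bounded t (pmean i t)"
  unfolding past_bounded_def using pmean_past_measurable
  by (auto intro!: exI[of _ 1] simp: abs_le_iff pmean_bounds less_imp_le order_trans[of _ 0])

lemma past_bounded_msg [bdd]: "1 \<le> t \<Longrightarrow> past_bounded (Suc t) (msg i t)"
  unfolding past_bounded_def msg_def[abs_def]
  by (auto intro!: exI[of _ 1] measurable_compose[OF message_past_measurable])

lemma integrable_past_bounded: "past_bounded t f \<Longrightarrow> integrable M f"
  unfolding past_bounded_def by (auto intro: integrable_bounded past_measurable)

lemma expectation_msg:
  assumes "1 \<le> t" "past_bounded t \<zeta>"
  shows "expectation (\<lambda>\<omega>. \<zeta> \<omega> * msg i t \<omega>) = expectation (\<lambda>\<omega>. \<zeta> \<omega> * pmean i t \<omega>)"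
    and "expectation (\<lambda>\<omega>. \<zeta> \<omega> * (msg Agent1 t \<omega> * msg Agent2 t \<omega>)) =
      expectation (\<lambda>\<omega>. \<zeta> \<omega> * (pmean Agent1 t \<omega> * pmean Agent2 t \<omega>))"
  using assms message_expectation[of t \<zeta>] unfolding past_bounded_def by blast+

definition avg :: "nat \<Rightarrow> 'a \<Rightarrow> real" where
  "avg t \<omega> = (pmean Agent1 t \<omega> + pmean Agent2 t \<omega>) / 2"

text \<open>
  The martingale increment of \<^const>\<open>avg\<close>.  The posterior mean at time \<open>t\<close> has denominator \<open>t + 2\<close> and
  at time \<open>t + 1\<close> denominator \<open>t + 3\<close>.
\<close>

definition incr :: "nat \<Rightarrow> 'a \<Rightarrow> real" where
  "incr t \<omega> = (msg Agent1 t \<omega> + msg Agent2 t \<omega> - pmean Agent1 t \<omega> - pmean Agent2 t \<omega>) / (2 * (real t + 3))"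

lemma avg_Suc: "1 \<le> t \<Longrightarrow> avg (Suc t) \<omega> = avg t \<omega> + incr t \<omega>"
  by (simp add: avg_def incr_def pmean_Suc divide_simps) (simp add: algebra_simps)

lemma avg_bounds: "0 < avg t \<omega>" "avg t \<omega> < 1"
  using pmean_bounds[of Agent1 t \<omega>] pmean_bounds[of Agent2 t \<omega>] by (auto simp: avg_def)

lemma incr_bound: "\<bar>incr t \<omega>\<bar> \<le> 1 / (real t + 3)"
proof -
  have "\<bar>msg Agent1 t \<omega> + msg Agent2 t \<omega> - pmean Agent1 t \<omega> - pmean Agent2 t \<omega>\<bar> \<le> 2"
    using pmean_bounds[of Agent1 t \<omega>] pmean_bounds[of Agent2 t \<omega>]
      msg_bounds[of Agent1 t \<omega>] msg_bounds[of Agent2 t \<omega>] by linarith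
  then have "\<bar>incr t \<omega>\<bar> \<le> 2 / (2 * (real t + 3))"
    unfolding incr_def abs_divide by (intro frac_le) auto
  also have "\<dots> = 1 / (real t + 3)"
    by (simp add: divide_simps)
  finally show ?thesis .
qed

lemma past_bounded_avg [bdd]: "past_bounded t (avg t)"
  unfolding avg_def[abs_def] by (intro bdd)

lemma past_bounded_incr [bdd]:
  assumes "1 \<le> t" shows "past_bounded (Suc t) (incr t)"
  unfolding incr_def[abs_def]
  by (intro bdd assms past_bounded_mono[OF past_bounded_pmean]) auto

lemma expectation_incr:
  assumes t: "1 \<le> t" and \<zeta>: "past_bounded t \<zeta>"
  shows "expectation (\<lambda>\<omega>. \<zeta> \<omega> * incr t \<omega>) = 0"
proof -
  note z = past_bounded_mono[OF \<zeta>, of "Suc t"] past_bounded_mono[OF past_bounded_pmean[of t], of "Suc t"]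
  have int: "integrable M (\<lambda>\<omega>. \<zeta> \<omega> * msg i t \<omega>)" "integrable M (\<lambda>\<omega>. \<zeta> \<omega> * pmean i t \<omega>)" for i
    using t by (auto intro!: integrable_past_bounded[of "Suc t"] bdd z)
  have "expectation (\<lambda>\<omega>. \<zeta> \<omega> * incr t \<omega>) = expectation (\<lambda>\<omega>. (\<zeta> \<omega> * msg Agent1 t \<omega> + \<zeta> \<omega> * msg Agent2 t \<omega>
      - \<zeta> \<omega> * pmean Agent1 t \<omega> - \<zeta> \<omega> * pmean Agent2 t \<omega>) / (2 * (real t + 3)))"
    by (intro Bochner_Integration.integral_cong) (auto simp: incr_def algebra_simps)
  also have "\<dots> = 0"
    using int by (simp add: expectation_msg[OF t \<zeta>])
  finally show ?thesis .
qed

text \<open>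
  The two messages are conditionally independent, so their variances add up.  Squares of messages are
  linear in them, which reduces the claim to expectations of the messages and of their product.
\<close>

lemma expectation_incr_square:
  assumes t: "1 \<le> t" and \<zeta>: "past_bounded t \<zeta>"
  shows "expectation (\<lambda>\<omega>. \<zeta> \<omega> * incr t \<omega> ^ 2) =
    expectation (\<lambda>\<omega>. \<zeta> \<omega> * (pmean Agent1 t \<omega> * (1 - pmean Agent1 t \<omega>) + pmean Agent2 t \<omega> * (1 - pmean Agent2 t \<omega>)))
      / (4 * (real t + 3) ^ 2)"
proof -
  let ?p = "pmean Agent1 t" and ?q = "pmean Agent2 t" and ?X = "msg Agent1 t" and ?Y = "msg Agent2 t"
  note z = past_bounded_mono[OF \<zeta>, of "Suc t"] past_bounded_mono[OF past_bounded_pmean[of t], of "Suc t"]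
  \<comment> \<open>coefficients of \<open>?X\<close> and \<open>?Y\<close>, of their product, and of 1 in the expanded square\<close>
  define \<alpha> where "\<alpha> \<omega> = \<zeta> \<omega> * (1 - 2 * ?p \<omega> - 2 * ?q \<omega>)" for \<omega>
  define \<gamma> where "\<gamma> \<omega> = \<zeta> \<omega> * (?p \<omega> + ?q \<omega>) ^ 2" for \<omega>
  define \<beta> where "\<beta> \<omega> = 2 * \<zeta> \<omega>" for \<omega>
  have pb: "past_bounded t \<alpha>" "past_bounded t \<beta>" "past_bounded t \<gamma>"
    unfolding \<alpha>_def \<beta>_def \<gamma>_def by (intro bdd \<zeta>)+
  note pb' = pb[THEN past_bounded_mono, of "Suc t"]
  have int: "integrable M (\<lambda>\<omega>. \<alpha> \<omega> * msg i t \<omega>)" "integrable M (\<lambda>\<omega>. \<alpha> \<omega> * pmean i t \<omega>)"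
    "integrable M (\<lambda>\<omega>. \<beta> \<omega> * (?X \<omega> * ?Y \<omega>))" "integrable M (\<lambda>\<omega>. \<beta> \<omega> * (?p \<omega> * ?q \<omega>))" "integrable M \<gamma>" for i
    using t by (auto intro!: integrable_past_bounded[of "Suc t"] bdd z pb')
  have "expectation (\<lambda>\<omega>. \<zeta> \<omega> * incr t \<omega> ^ 2) =
    expectation (\<lambda>\<omega>. (\<alpha> \<omega> * ?X \<omega> + \<alpha> \<omega> * ?Y \<omega> + \<beta> \<omega> * (?X \<omega> * ?Y \<omega>) + \<gamma> \<omega>) / (4 * (real t + 3) ^ 2))"
  proof (intro Bochner_Integration.integral_cong refl)
    fix \<omega>
    have "(?X \<omega> + ?Y \<omega> - ?p \<omega> - ?q \<omega>) ^ 2 =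
       ?X \<omega> ^ 2 + ?Y \<omega> ^ 2 + 2 * ?X \<omega> * ?Y \<omega> - 2 * (?X \<omega> + ?Y \<omega>) * (?p \<omega> + ?q \<omega>) + (?p \<omega> + ?q \<omega>) ^ 2"
      by (simp add: power2_eq_square algebra_simps)
    also have "\<dots> = (1 - 2 * ?p \<omega> - 2 * ?q \<omega>) * ?X \<omega> + (1 - 2 * ?p \<omega> - 2 * ?q \<omega>) * ?Y \<omega> + 2 * (?X \<omega> * ?Y \<omega>) + (?p \<omega> + ?q \<omega>) ^ 2"
      unfolding msg_square by (simp add: algebra_simps)
    finally have sq: "(?X \<omega> + ?Y \<omega> - ?p \<omega> - ?q \<omega>) ^ 2 = \<dots>" .
    have "\<zeta> \<omega> * incr t \<omega> ^ 2 = \<zeta> \<omega> * (?X \<omega> + ?Y \<omega> - ?p \<omega> - ?q \<omega>) ^ 2 / (4 * (real t + 3) ^ 2)"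
      by (simp add: incr_def power_divide power_mult_distrib del: distrib_left_numeral)
    also have "\<zeta> \<omega> * (?X \<omega> + ?Y \<omega> - ?p \<omega> - ?q \<omega>) ^ 2 = \<alpha> \<omega> * ?X \<omega> + \<alpha> \<omega> * ?Y \<omega> + \<beta> \<omega> * (?X \<omega> * ?Y \<omega>) + \<gamma> \<omega>"
      unfolding sq by (simp add: \<alpha>_def \<beta>_def \<gamma>_def distrib_left mult.assoc mult.left_commute)
    finally show "\<zeta> \<omega> * incr t \<omega> ^ 2 = (\<alpha> \<omega> * ?X \<omega> + \<alpha> \<omega> * ?Y \<omega> + \<beta> \<omega> * (?X \<omega> * ?Y \<omega>) + \<gamma> \<omega>) / (4 * (real t + 3) ^ 2)" .
  qed
  also have "\<dots> = (expectation (\<lambda>\<omega>. \<alpha> \<omega> * ?p \<omega>) + expectation (\<lambda>\<omega>. \<alpha> \<omega> * ?q \<omega>) +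
      expectation (\<lambda>\<omega>. \<beta> \<omega> * (?p \<omega> * ?q \<omega>)) + expectation \<gamma>) / (4 * (real t + 3) ^ 2)"
    using int by (simp add: expectation_msg[OF t pb(1)] expectation_msg(2)[OF t pb(2)])
  also have "\<dots> = expectation (\<lambda>\<omega>. (\<alpha> \<omega> * ?p \<omega> + \<alpha> \<omega> * ?q \<omega> + \<beta> \<omega> * (?p \<omega> * ?q \<omega>) + \<gamma> \<omega>)) / (4 * (real t + 3) ^ 2)"
    using int by simp
  also have "(\<lambda>\<omega>. (\<alpha> \<omega> * ?p \<omega> + \<alpha> \<omega> * ?q \<omega> + \<beta> \<omega> * (?p \<omega> * ?q \<omega>) + \<gamma> \<omega>)) =
     (\<lambda>\<omega>. \<zeta> \<omega> * (?p \<omega> * (1 - ?p \<omega>) + ?q \<omega> * (1 - ?q \<omega>)))"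
    by (auto simp: \<alpha>_def \<beta>_def \<gamma>_def power2_eq_square algebra_simps)
  finally show ?thesis .
qed

text \<open>
  The reference point \<open>b\<close> is a random variable of the past, so that the same recursion serves for the
  Cauchy property (\<open>b\<close> an earlier value of \<^const>\<open>avg\<close>) and for anti-concentration (\<open>b\<close> a constant).
\<close>

lemma second_moment_step:
  assumes t: "1 \<le> t" and \<zeta>: "past_bounded t \<zeta>" and b: "past_bounded t b"
  shows "expectation (\<lambda>\<omega>. \<zeta> \<omega> * (avg (Suc t) \<omega> - b \<omega>) ^ 2) =
    expectation (\<lambda>\<omega>. \<zeta> \<omega> * (avg t \<omega> - b \<omega>) ^ 2) + expectation (\<lambda>\<omega>. \<zeta> \<omega> * incr t \<omega> ^ 2)"
proof -
  note z = \<zeta>[THEN past_bounded_mono, of "Suc t"] b[THEN past_bounded_mono, of "Suc t"]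
    past_bounded_avg[THEN past_bounded_mono, of t "Suc t"]
  have int: "integrable M (\<lambda>\<omega>. \<zeta> \<omega> * (avg t \<omega> - b \<omega>) ^ 2)" "integrable M (\<lambda>\<omega>. (2 * \<zeta> \<omega> * (avg t \<omega> - b \<omega>)) * incr t \<omega>)"
     "integrable M (\<lambda>\<omega>. \<zeta> \<omega> * incr t \<omega> ^ 2)"
    using t by (auto intro!: integrable_past_bounded[of "Suc t"] bdd z)
  have "expectation (\<lambda>\<omega>. \<zeta> \<omega> * (avg (Suc t) \<omega> - b \<omega>) ^ 2) =
     expectation (\<lambda>\<omega>. \<zeta> \<omega> * (avg t \<omega> - b \<omega>) ^ 2 + (2 * \<zeta> \<omega> * (avg t \<omega> - b \<omega>)) * incr t \<omega> + \<zeta> \<omega> * incr t \<omega> ^ 2)"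
    by (intro Bochner_Integration.integral_cong) (auto simp: avg_Suc[OF t] power2_eq_square algebra_simps)
  also have "\<dots> = expectation (\<lambda>\<omega>. \<zeta> \<omega> * (avg t \<omega> - b \<omega>) ^ 2) +
      expectation (\<lambda>\<omega>. (2 * \<zeta> \<omega> * (avg t \<omega> - b \<omega>)) * incr t \<omega>) + expectation (\<lambda>\<omega>. \<zeta> \<omega> * incr t \<omega> ^ 2)"
    using int by simp
  also have "expectation (\<lambda>\<omega>. (2 * \<zeta> \<omega> * (avg t \<omega> - b \<omega>)) * incr t \<omega>) = 0"
    by (intro expectation_incr t bdd \<zeta> b)
  finally show ?thesis by simp
qed

lemma inverse_square_le_telescope: "1 / (real t + 3) ^ 2 \<le> 1 / (real t + 2) - 1 / (real (Suc t) + 2)"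
  by (simp add: divide_simps power2_eq_square) (simp add: algebra_simps)

lemma second_moment_upper:
  assumes s: "1 \<le> s" and \<zeta>: "past_bounded s \<zeta>" "\<And>\<omega>. 0 \<le> \<zeta> \<omega>" and b: "past_bounded s b" and "s \<le> r"
  shows "expectation (\<lambda>\<omega>. \<zeta> \<omega> * (avg r \<omega> - b \<omega>) ^ 2) \<le>
    expectation (\<lambda>\<omega>. \<zeta> \<omega> * (avg s \<omega> - b \<omega>) ^ 2) + (1 / (real s + 2) - 1 / (real r + 2)) * expectation \<zeta>"
  using \<open>s \<le> r\<close>
proof (induction r rule: dec_induct)
  case (step r)
  note z = \<zeta>(1)[THEN past_bounded_mono, OF \<open>s \<le> r\<close>] b[THEN past_bounded_mono, OF \<open>s \<le> r\<close>]
  have r: "1 \<le> r" using s step.hyps by simp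
  have E: "0 \<le> expectation \<zeta>" using \<zeta>(2) by (intro integral_nonneg_AE) auto
  have "expectation (\<lambda>\<omega>. \<zeta> \<omega> * incr r \<omega> ^ 2) \<le> expectation (\<lambda>\<omega>. \<zeta> \<omega> * (1 / (real r + 3) ^ 2))"
  proof (rule integral_mono)
    fix \<omega>
    have "incr r \<omega> ^ 2 \<le> (1 / (real r + 3)) ^ 2"
      using incr_bound[of r \<omega>] by (metis abs_ge_zero power2_abs power_mono)
    then show "\<zeta> \<omega> * incr r \<omega> ^ 2 \<le> \<zeta> \<omega> * (1 / (real r + 3) ^ 2)"
      using \<zeta>(2) by (intro mult_left_mono) (auto simp: power_divide)
  qed (auto intro!: integrable_past_bounded[of "Suc r"] bdd z[THEN past_bounded_mono] r)
  also have "\<dots> = 1 / (real r + 3) ^ 2 * expectation \<zeta>" by simp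
  also have "\<dots> \<le> (1 / (real r + 2) - 1 / (real (Suc r) + 2)) * expectation \<zeta>"
    by (intro mult_right_mono inverse_square_le_telescope E)
  finally show ?case
    using step.IH second_moment_step[OF r z] by (simp add: algebra_simps)
qed simp

text \<open>
  In terms of the rescaled difference \<open>J\<close>, one time step adds the message of agent 2 and subtracts that of
  agent 1.  Their conditional expectations differ by \<open>- J / (t + 2)\<close>, so the cross term is negative and
  the second moment of \<open>J\<close> grows by at most 1 in each step.
\<close>

lemma pmean_diff_second_moment:
  assumes "1 \<le> t"
  shows "expectation (\<lambda>\<omega>. (pmean Agent1 t \<omega> - pmean Agent2 t \<omega>) ^ 2) \<le> 1 / real t"
proof -
  define J where "J t \<omega> = (real t + 2) * (pmean Agent1 t \<omega> - pmean Agent2 t \<omega>)" for t \<omega>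
  have J[bdd]: "past_bounded t (J t)" for t
    unfolding J_def[abs_def] by (intro bdd)
  have "expectation (\<lambda>\<omega>. J t \<omega> ^ 2) \<le> real t"
    using assms
  proof (induction t rule: dec_induct)
    case base
    have "J 1 \<omega> ^ 2 \<le> 1" for \<omega>
      by (auto simp: J_def pmean_def post_mean_def obs_def)
    then have "expectation (\<lambda>\<omega>. J 1 \<omega> ^ 2) \<le> expectation (\<lambda>\<omega>. 1)"
      by (intro integral_mono integrable_past_bounded[of 1] bdd)
    then show ?case by (simp add: prob_space)
  next
    case (step t)
    let ?d = "\<lambda>\<omega>. msg Agent2 t \<omega> - msg Agent1 t \<omega>"
    have z: "past_bounded (Suc t) (J t)" "past_bounded (Suc t) ?d"
      using step.hyps by (auto intro!: bdd past_bounded_mono[OF J])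
    have Suc: "J (Suc t) \<omega> = J t \<omega> + ?d \<omega>" for \<omega>
      using step.hyps by (simp add: J_def pmean_Suc add.commute flip: diff_divide_distrib) (simp add: algebra_simps)
    have "expectation (\<lambda>\<omega>. J (Suc t) \<omega> ^ 2) = expectation (\<lambda>\<omega>. J t \<omega> ^ 2 + 2 * (J t \<omega> * ?d \<omega>) + ?d \<omega> ^ 2)"
      by (intro Bochner_Integration.integral_cong) (auto simp: Suc power2_eq_square algebra_simps)
    also have "\<dots> = expectation (\<lambda>\<omega>. J t \<omega> ^ 2) + 2 * expectation (\<lambda>\<omega>. J t \<omega> * ?d \<omega>) + expectation (\<lambda>\<omega>. ?d \<omega> ^ 2)"
    proof -
      have "integrable M (\<lambda>\<omega>. J t \<omega> ^ 2)" "integrable M (\<lambda>\<omega>. J t \<omega> * ?d \<omega>)" "integrable M (\<lambda>\<omega>. ?d \<omega> ^ 2)"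
        by (intro integrable_past_bounded[of "Suc t"] bdd z)+
      then show ?thesis by simp
    qed
    also have "expectation (\<lambda>\<omega>. J t \<omega> * ?d \<omega>) = expectation (\<lambda>\<omega>. J t \<omega> * (pmean Agent2 t \<omega> - pmean Agent1 t \<omega>))"
    proof -
      have "integrable M (\<lambda>\<omega>. J t \<omega> * msg i t \<omega>)" "integrable M (\<lambda>\<omega>. J t \<omega> * pmean i t \<omega>)" for i
        using step.hyps
        by (auto intro!: integrable_past_bounded[of "Suc t"] bdd z past_bounded_pmean[THEN past_bounded_mono])
      then show ?thesis
        using step.hyps by (simp add: right_diff_distrib expectation_msg(1)[OF _ J])
    qed
    also have "\<dots> \<le> expectation (\<lambda>\<omega>. 0)"
    proof (rule integral_mono)
      fix \<omega>
      have "J t \<omega> * (pmean Agent2 t \<omega> - pmean Agent1 t \<omega>) = - ((real t + 2) * (pmean Agent2 t \<omega> - pmean Agent1 t \<omega>) ^ 2)"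
        by (simp add: J_def power2_eq_square algebra_simps)
      then show "J t \<omega> * (pmean Agent2 t \<omega> - pmean Agent1 t \<omega>) \<le> 0" by simp
    qed (auto intro!: integrable_past_bounded[of "t"] bdd)
    also have "expectation (\<lambda>\<omega>. ?d \<omega> ^ 2) \<le> expectation (\<lambda>\<omega>. 1)"
      by (intro integral_mono integrable_past_bounded[of "Suc t"] bdd z) (auto simp: msg_def)
    finally show ?case
      using step.IH by (simp add: prob_space)
  qed
  also have "expectation (\<lambda>\<omega>. J t \<omega> ^ 2) = (real t + 2) ^ 2 * expectation (\<lambda>\<omega>. (pmean Agent1 t \<omega> - pmean Agent2 t \<omega>) ^ 2)"
    by (simp add: J_def power_mult_distrib)
  finally have "expectation (\<lambda>\<omega>. (pmean Agent1 t \<omega> - pmean Agent2 t \<omega>) ^ 2) \<le> real t / (real t + 2) ^ 2"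
    by (simp add: field_simps)
  also have "\<dots> \<le> 1 / real t"
    using assms mult_mono[of "real t" "real t + 2" "real t" "real t + 2"]
    by (simp add: divide_simps power2_eq_square)
  finally show ?thesis .
qed

lemma pmean_slow:
  assumes "1 \<le> t" shows "\<bar>pmean i (Suc t) \<omega> - pmean i t \<omega>\<bar> \<le> 1 / (real t + 3)"
proof -
  have "pmean i (Suc t) \<omega> - pmean i t \<omega> = (msg (other i) t \<omega> - pmean i t \<omega>) / (real t + 3)"
    using assms by (simp add: pmean_Suc divide_simps) (simp add: algebra_simps)
  also have "\<bar>\<dots>\<bar> \<le> 1 / (real t + 3)"
    unfolding abs_divide using pmean_bounds[of i t \<omega>] msg_bounds[of "other i" t \<omega>]
    by (intro frac_le) auto
  finally show ?thesis .
qed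

text \<open>
  Along the times \<open>\<tau> n = (n + 1) ^ 4\<close> the second moments of the difference of the means and of the
  increments of \<^const>\<open>avg\<close> are at most \<open>(n + 1) ^ (-4)\<close>.  The increments themselves have to be absolutely
  summable; the exponent 4 leaves room for the factor \<open>(n + 1)\<^sup>2\<close> that the inequality
  \<open>y \<le> N\<^sup>2 * y\<^sup>2 + 1 / N\<^sup>2\<close> costs, and it still keeps the gaps between the times relatively small.
\<close>

lemma pmean_converge: "AE \<omega> in M. \<exists>L. \<forall>i. (\<lambda>t. pmean i t \<omega>) \<longlonglongrightarrow> L"
proof -
  define \<tau> where "\<tau> n = (Suc n) ^ 4" for n
  have \<tau>1: "1 \<le> \<tau> n" for n by (simp add: \<tau>_def)
  have \<tau>mono: "\<tau> n \<le> \<tau> (Suc n)" for n unfolding \<tau>_def by (intro power_mono) auto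
  have summ: "summable (\<lambda>n. 1 / real (Suc n) ^ 2)"
    using inverse_power_summable[of 2, where 'a=real] by (subst summable_Suc_iff) (simp add: inverse_eq_divide)
  have "AE \<omega> in M. summable (\<lambda>n. (pmean Agent1 (\<tau> n) \<omega> - pmean Agent2 (\<tau> n) \<omega>) ^ 2)"
  proof (rule AE_summable_of_expectation[OF _ _ _ summ])
    fix n
    show "integrable M (\<lambda>\<omega>. (pmean Agent1 (\<tau> n) \<omega> - pmean Agent2 (\<tau> n) \<omega>) ^ 2)"
      by (intro integrable_past_bounded[of "\<tau> n"] bdd)
    have "expectation (\<lambda>\<omega>. (pmean Agent1 (\<tau> n) \<omega> - pmean Agent2 (\<tau> n) \<omega>) ^ 2) \<le> 1 / real (\<tau> n)"
      by (rule pmean_diff_second_moment[OF \<tau>1])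
    also have "\<dots> \<le> 1 / real (Suc n) ^ 2"
      unfolding \<tau>_def of_nat_power by (intro divide_left_mono power_increasing mult_pos_pos zero_less_power) auto
    finally show "expectation (\<lambda>\<omega>. (pmean Agent1 (\<tau> n) \<omega> - pmean Agent2 (\<tau> n) \<omega>) ^ 2) \<le> 1 / real (Suc n) ^ 2" .
  qed auto
  moreover have "AE \<omega> in M. summable (\<lambda>n. real (Suc n) ^ 2 * (avg (\<tau> (Suc n)) \<omega> - avg (\<tau> n) \<omega>) ^ 2)"
  proof (rule AE_summable_of_expectation[OF _ _ _ summ])
    fix n
    show "integrable M (\<lambda>\<omega>. real (Suc n) ^ 2 * (avg (\<tau> (Suc n)) \<omega> - avg (\<tau> n) \<omega>) ^ 2)"
      by (intro integrable_past_bounded[of "\<tau> (Suc n)"] bdd past_bounded_mono[OF past_bounded_avg \<tau>mono])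
    have "expectation (\<lambda>\<omega>. 1 * (avg (\<tau> (Suc n)) \<omega> - avg (\<tau> n) \<omega>) ^ 2) \<le>
      expectation (\<lambda>\<omega>. 1 * (avg (\<tau> n) \<omega> - avg (\<tau> n) \<omega>) ^ 2) + (1 / (real (\<tau> n) + 2) - 1 / (real (\<tau> (Suc n)) + 2)) * expectation (\<lambda>\<omega>. 1)"
      by (intro second_moment_upper \<tau>1 \<tau>mono bdd) auto
    then have "expectation (\<lambda>\<omega>. (avg (\<tau> (Suc n)) \<omega> - avg (\<tau> n) \<omega>) ^ 2) \<le> 1 / (real (\<tau> n) + 2) - 1 / (real (\<tau> (Suc n)) + 2)"
      by (simp add: prob_space)
    also have "\<dots> \<le> 1 / real (\<tau> n)"
      using \<tau>1[of n] by (smt (verit) frac_le of_nat_0_le_iff divide_nonneg_nonneg of_nat_1 of_nat_le_iff)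
    finally have "real (Suc n) ^ 2 * expectation (\<lambda>\<omega>. (avg (\<tau> (Suc n)) \<omega> - avg (\<tau> n) \<omega>) ^ 2) \<le> real (Suc n) ^ 2 * (1 / real (\<tau> n))"
      by (intro mult_left_mono) auto
    also have "\<dots> = 1 / real (Suc n) ^ 2"
      unfolding \<tau>_def of_nat_power by (simp add: power2_eq_square power4_eq_xxxx del: of_nat_Suc)
    finally show "expectation (\<lambda>\<omega>. real (Suc n) ^ 2 * (avg (\<tau> (Suc n)) \<omega> - avg (\<tau> n) \<omega>) ^ 2) \<le> 1 / real (Suc n) ^ 2"
      by simp
  qed auto
  ultimately show ?thesis
  proof eventually_elim
    case (elim \<omega>)
    have "(\<lambda>n. (pmean Agent1 (\<tau> n) \<omega> - pmean Agent2 (\<tau> n) \<omega>) ^ 2) \<longlonglongrightarrow> 0"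
      using elim(1) by (rule summable_LIMSEQ_zero)
    then have D: "(\<lambda>n. pmean Agent1 (\<tau> n) \<omega> - pmean Agent2 (\<tau> n) \<omega>) \<longlonglongrightarrow> 0"
      by simp
    have "summable (\<lambda>n. avg (\<tau> (Suc n)) \<omega> - avg (\<tau> n) \<omega>)"
    proof (rule summable_comparison_test')
      show "summable (\<lambda>n. real (Suc n) ^ 2 * (avg (\<tau> (Suc n)) \<omega> - avg (\<tau> n) \<omega>) ^ 2 + 1 / real (Suc n) ^ 2)"
        by (intro summable_add elim(2) summ)
      fix n
      define y where "y = \<bar>avg (\<tau> (Suc n)) \<omega> - avg (\<tau> n) \<omega>\<bar>"
      define N where "N = real (Suc n)"
      have N: "N > 0" by (simp add: N_def)
      have "0 \<le> (N * y - 1 / N) ^ 2" by simp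
      also have "\<dots> = N ^ 2 * y ^ 2 + 1 / N ^ 2 - 2 * y"
        using N by (simp add: power2_eq_square field_simps)
      finally have "y \<le> N ^ 2 * y ^ 2 + 1 / N ^ 2" using y_def by linarith
      then show "norm (avg (\<tau> (Suc n)) \<omega> - avg (\<tau> n) \<omega>) \<le> real (Suc n) ^ 2 * (avg (\<tau> (Suc n)) \<omega> - avg (\<tau> n) \<omega>) ^ 2 + 1 / real (Suc n) ^ 2"
        by (simp add: y_def N_def)
    qed
    then have "(\<lambda>n. \<Sum>k<n. avg (\<tau> (Suc k)) \<omega> - avg (\<tau> k) \<omega>) \<longlonglongrightarrow> (\<Sum>n. avg (\<tau> (Suc n)) \<omega> - avg (\<tau> n) \<omega>)"
      by (rule summable_LIMSEQ)
    then have "(\<lambda>n. avg (\<tau> n) \<omega> - avg (\<tau> 0) \<omega>) \<longlonglongrightarrow> (\<Sum>n. avg (\<tau> (Suc n)) \<omega> - avg (\<tau> n) \<omega>)"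
      unfolding sum_lessThan_telescope[of "\<lambda>n. avg (\<tau> n) \<omega>"] .
    from tendsto_add[OF this tendsto_const[of "avg (\<tau> 0) \<omega>"]]
    obtain L where L: "(\<lambda>n. avg (\<tau> n) \<omega>) \<longlonglongrightarrow> L" by simp
    have "(\<lambda>t. pmean i t \<omega>) \<longlonglongrightarrow> L" for i
    proof (rule slow_variation_limit)
      show "\<bar>pmean i (Suc t) \<omega> - pmean i t \<omega>\<bar> \<le> 1 / real t" if "1 \<le> t" for t
        using that by (intro order_trans[OF pmean_slow]) (auto intro!: frac_le)
      have "(\<lambda>n. avg (\<tau> n) \<omega> + (pmean Agent1 (\<tau> n) \<omega> - pmean Agent2 (\<tau> n) \<omega>) / 2) \<longlonglongrightarrow> L + 0 / 2"
        "(\<lambda>n. avg (\<tau> n) \<omega> - (pmean Agent1 (\<tau> n) \<omega> - pmean Agent2 (\<tau> n) \<omega>) / 2) \<longlonglongrightarrow> L - 0 / 2"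
        by (intro tendsto_intros L D; simp)+
      then have "(\<lambda>n. pmean i (\<tau> n) \<omega>) \<longlonglongrightarrow> L"
        by (cases i) (simp_all add: avg_def field_simps)
      then show "(\<lambda>n. pmean i (n ^ 4) \<omega>) \<longlonglongrightarrow> L"
        unfolding \<tau>_def by (rule LIMSEQ_imp_Suc)
    qed
    then show ?case by blast
  qed
qed

text \<open>
  The truncation makes the value lie in the unit interval also on the null set on which \<^const>\<open>avg\<close>
  may fail to converge.
\<close>

definition consensus :: "'a \<Rightarrow> real" where
  "consensus \<omega> = min 1 (max 0 (lim (\<lambda>t. avg t \<omega>)))"

lemma avg_measurable: "avg t \<in> borel_measurable M"
  using past_bounded_avg past_measurable unfolding past_bounded_def by blast

lemma consensus_measurable: "consensus \<in> borel_measurable M"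
proof -
  have "(\<lambda>\<omega>. lim (\<lambda>t. avg t \<omega>)) \<in> borel_measurable M"
    by (intro borel_measurable_lim_metric avg_measurable)
  then show ?thesis unfolding consensus_def[abs_def] by measurable
qed

lemma pmean_tendsto_consensus: "AE \<omega> in M. \<forall>i. (\<lambda>t. pmean i t \<omega>) \<longlonglongrightarrow> consensus \<omega>"
  using pmean_converge
proof eventually_elim
  case (elim \<omega>)
  then obtain L where L: "\<And>i. (\<lambda>t. pmean i t \<omega>) \<longlonglongrightarrow> L" by blast
  have "(\<lambda>t. avg t \<omega>) \<longlonglongrightarrow> (L + L) / 2"
    unfolding avg_def by (intro tendsto_intros L) simp
  then have "lim (\<lambda>t. avg t \<omega>) = L" by (simp add: limI)
  moreover have "0 \<le> L" "L \<le> 1"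
    using pmean_bounds[of Agent1 _ \<omega>]
    by (auto intro!: LIMSEQ_le_const[OF L[of Agent1]] LIMSEQ_le_const2[OF L[of Agent1]] exI[of _ 0] intro: less_imp_le)
  ultimately show ?case using L by (simp add: consensus_def)
qed

end

section \<open>Anti-concentration of the limit\<close>

text \<open>
  The cubic term \<open>4 * w * \<xi> ^ 3\<close> is absorbed by completing the square \<open>2 * (w * \<xi> - \<xi>\<^sup>2)\<^sup>2\<close>; the linear
  term is kept because its expectation vanishes for a martingale increment.
\<close>

lemma fourth_power_step:
  fixes w \<xi> :: real
  assumes "\<bar>\<xi>\<bar> \<le> h"
  shows "(w + \<xi>) ^ 4 \<le> w ^ 4 + 4 * w ^ 3 * \<xi> + 8 * h\<^sup>2 * w\<^sup>2 + 3 * h ^ 4"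
proof -
  have h: "\<xi>\<^sup>2 \<le> h\<^sup>2" using assms by (simp add: abs_le_square_iff[symmetric])
  have "(w + \<xi>) ^ 4 = w ^ 4 + 4 * w ^ 3 * \<xi> + 8 * \<xi>\<^sup>2 * w\<^sup>2 + 3 * (\<xi>\<^sup>2)\<^sup>2 - 2 * (w * \<xi> - \<xi>\<^sup>2)\<^sup>2"
    by (simp add: power4_eq_xxxx power3_eq_cube power2_eq_square algebra_simps)
  also have "\<dots> \<le> w ^ 4 + 4 * w ^ 3 * \<xi> + 8 * \<xi>\<^sup>2 * w\<^sup>2 + 3 * (\<xi>\<^sup>2)\<^sup>2"
    by simp
  also have "\<dots> \<le> w ^ 4 + 4 * w ^ 3 * \<xi> + 8 * h\<^sup>2 * w\<^sup>2 + 3 * (h\<^sup>2)\<^sup>2"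
    using mult_right_mono[OF h, of "w\<^sup>2"] power_mono[OF h, of 2] by (simp add: mult.assoc)
  finally show ?thesis by simp
qed

context misspecified_bernoulli_sampling
begin

lemma past_bounded_inverse:
  assumes "past_bounded t f" "\<epsilon> > 0" "\<And>\<omega>. \<epsilon> \<le> f \<omega>"
  shows "past_bounded t (\<lambda>\<omega>. 1 / f \<omega>)"
proof -
  have "\<bar>1 / f \<omega>\<bar> \<le> 1 / \<epsilon>" for \<omega>
    using assms(2) assms(3)[of \<omega>] by (simp add: frac_le)
  then show ?thesis using assms(1) unfolding past_bounded_def by auto
qed

lemma expectation_nonneg:
  fixes f :: "'a \<Rightarrow> real" shows "(\<And>\<omega>. 0 \<le> f \<omega>) \<Longrightarrow> 0 \<le> expectation f"
  by (intro integral_nonneg_AE) auto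

lemma second_moment_mono:
  assumes s: "1 \<le> s" and \<zeta>: "past_bounded s \<zeta>" "\<And>\<omega>. 0 \<le> \<zeta> \<omega>" and b: "past_bounded s b" and "s \<le> q" "q \<le> r"
  shows "expectation (\<lambda>\<omega>. \<zeta> \<omega> * (avg q \<omega> - b \<omega>) ^ 2) \<le> expectation (\<lambda>\<omega>. \<zeta> \<omega> * (avg r \<omega> - b \<omega>) ^ 2)"
  using \<open>q \<le> r\<close>
proof (induction r rule: dec_induct)
  case (step r)
  then have r: "1 \<le> r" "s \<le> r" using s \<open>s \<le> q\<close> by auto
  have "0 \<le> expectation (\<lambda>\<omega>. \<zeta> \<omega> * incr r \<omega> ^ 2)"
    using \<zeta>(2) by (intro expectation_nonneg) auto
  then show ?case
    using step.IH second_moment_step[OF r(1) past_bounded_mono[OF \<zeta>(1) r(2)] past_bounded_mono[OF b r(2)]] by simp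
qed simp

text \<open>
  A mean moves by at most \<open>1 / s\<close> in a step after time \<open>s\<close>, so during the first \<open>L\<close> steps, with \<open>L\<close> about
  \<open>\<eta> * s / 2\<close>, both means stay between \<open>\<eta> / 2\<close> and \<open>1 - \<eta> / 2\<close>.  Each of these steps contributes at least
  \<open>\<kappa> = \<eta> / (72 * s\<^sup>2)\<close> to the second moment, and \<open>L \<ge> \<eta> * s / 4\<close> of them give \<open>\<eta>\<^sup>2 / (288 * s)\<close>; the later
  steps can only increase it.
\<close>

lemma second_moment_lower:
  assumes \<eta>: "0 < \<eta>" "\<eta> \<le> 1 / 2" and s: "4 / \<eta> \<le> real s"
    and \<zeta>: "past_bounded s \<zeta>" "\<And>\<omega>. 0 \<le> \<zeta> \<omega>"
    and supp: "\<And>\<omega> i. \<zeta> \<omega> \<noteq> 0 \<Longrightarrow> \<eta> \<le> pmean i s \<omega> \<and> pmean i s \<omega> \<le> 1 - \<eta>"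
    and b: "past_bounded s b" and r: "2 * s \<le> r"
  shows "expectation (\<lambda>\<omega>. \<zeta> \<omega> * (avg s \<omega> - b \<omega>) ^ 2) + \<eta>\<^sup>2 / (288 * real s) * expectation \<zeta> \<le>
    expectation (\<lambda>\<omega>. \<zeta> \<omega> * (avg r \<omega> - b \<omega>) ^ 2)"
proof -
  have "8 \<le> 4 / \<eta>" using \<eta> by (simp add: field_simps)
  then have s8: "8 \<le> real s" using s by linarith
  then have s1: "1 \<le> s" by linarith
  have \<eta>s: "4 \<le> \<eta> * real s" using s \<eta> by (simp add: field_simps)
  define L where "L = nat \<lfloor>\<eta> * real s / 2\<rfloor>"
  have L: "real L \<le> \<eta> * real s / 2" "\<eta> * real s / 4 \<le> real L"
    using \<eta>s unfolding L_def by (auto simp: of_nat_nat) linarith+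
  have "\<eta> * real s \<le> 1 / 2 * real s" using \<eta> by (intro mult_right_mono) auto
  then have Ls: "real L \<le> real s / 4" using L by linarith
  define \<kappa> where "\<kappa> = \<eta> / (72 * real s ^ 2)"
  have step: "\<kappa> * expectation \<zeta> \<le> expectation (\<lambda>\<omega>. \<zeta> \<omega> * incr (s + l) \<omega> ^ 2)" if l: "l < L" for l
  proof -
    let ?q = "s + l"
    let ?v = "\<lambda>\<omega>. pmean Agent1 ?q \<omega> * (1 - pmean Agent1 ?q \<omega>) + pmean Agent2 ?q \<omega> * (1 - pmean Agent2 ?q \<omega>)"
    have q1: "1 \<le> ?q" using s1 by simp
    have zq: "past_bounded ?q \<zeta>" by (rule past_bounded_mono[OF \<zeta>(1)]) simp
    have var: "\<eta> / 4 \<le> pmean i ?q \<omega> * (1 - pmean i ?q \<omega>)" if "\<zeta> \<omega> \<noteq> 0" for i \<omega>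
    proof -
      have "\<bar>pmean i ?q \<omega> - pmean i s \<omega>\<bar> \<le> real (?q - s) / real s"
      proof (rule slow_variation_bound[OF _ s1])
        show "\<bar>pmean i (Suc t) \<omega> - pmean i t \<omega>\<bar> \<le> 1 / real t" if "1 \<le> t" for t
          using that by (intro order_trans[OF pmean_slow]) (auto intro!: frac_le)
      qed simp
      also have "\<dots> \<le> \<eta> / 2"
        using l L(1) s8 by (simp add: divide_simps)
      finally have h: "\<eta> / 2 \<le> pmean i ?q \<omega>" "pmean i ?q \<omega> \<le> 1 - \<eta> / 2"
        using supp[OF that, of i] by linarith+
      have "0 \<le> (pmean i ?q \<omega> - \<eta> / 2) * (1 - \<eta> / 2 - pmean i ?q \<omega>)"
        using h by (intro mult_nonneg_nonneg) auto
      then have "\<eta> / 2 * (1 - \<eta> / 2) \<le> pmean i ?q \<omega> * (1 - pmean i ?q \<omega>)"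
        by (simp add: algebra_simps)
      moreover have "\<eta> / 2 * (1 / 2) \<le> \<eta> / 2 * (1 - \<eta> / 2)"
        using \<eta> by (intro mult_left_mono) auto
      ultimately show ?thesis by simp
    qed
    have "\<eta> / 2 * expectation \<zeta> = expectation (\<lambda>\<omega>. \<zeta> \<omega> * (\<eta> / 2))" by simp
    also have "\<dots> \<le> expectation (\<lambda>\<omega>. \<zeta> \<omega> * ?v \<omega>)"
    proof (rule integral_mono)
      show "\<zeta> \<omega> * (\<eta> / 2) \<le> \<zeta> \<omega> * ?v \<omega>" for \<omega>
        using var[of \<omega> Agent1] var[of \<omega> Agent2] \<zeta>(2)[of \<omega>] by (cases "\<zeta> \<omega> = 0") (auto intro!: mult_left_mono)
    qed (intro integrable_past_bounded[of ?q] bdd zq)+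
    finally have E: "\<eta> / 2 * expectation \<zeta> \<le> expectation (\<lambda>\<omega>. \<zeta> \<omega> * ?v \<omega>)" .
    have "real ?q + 3 \<le> 3 * real s" using l Ls s8 by simp
    then have "(real ?q + 3) ^ 2 \<le> (3 * real s) ^ 2" by (intro power_mono) auto
    then have "4 * (real ?q + 3) ^ 2 \<le> 36 * real s ^ 2" by (simp add: power_mult_distrib)
    then have "\<eta> / 2 * expectation \<zeta> / (36 * real s ^ 2) \<le> expectation (\<lambda>\<omega>. \<zeta> \<omega> * ?v \<omega>) / (4 * (real ?q + 3) ^ 2)"
    proof (intro frac_le E)
      show "0 \<le> expectation (\<lambda>\<omega>. \<zeta> \<omega> * ?v \<omega>)"
        using \<eta> by (intro order_trans[OF _ E] mult_nonneg_nonneg expectation_nonneg \<zeta>(2)) auto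
    qed (auto simp: add_pos_nonneg)
    then show ?thesis
      unfolding expectation_incr_square[OF q1 zq] by (simp add: \<kappa>_def)
  qed
  have "expectation (\<lambda>\<omega>. \<zeta> \<omega> * (avg s \<omega> - b \<omega>) ^ 2) + real l * (\<kappa> * expectation \<zeta>) \<le>
      expectation (\<lambda>\<omega>. \<zeta> \<omega> * (avg (s + l) \<omega> - b \<omega>) ^ 2)" if "l \<le> L" for l
    using that
  proof (induction l)
    case (Suc l)
    have "1 \<le> s + l" using s1 by simp
    from second_moment_step[OF this past_bounded_mono[OF \<zeta>(1)] past_bounded_mono[OF b]] step[of l] Suc
    show ?case by (simp add: algebra_simps)
  qed simp
  from this[of L]
  have "expectation (\<lambda>\<omega>. \<zeta> \<omega> * (avg s \<omega> - b \<omega>) ^ 2) + real L * (\<kappa> * expectation \<zeta>) \<le>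
      expectation (\<lambda>\<omega>. \<zeta> \<omega> * (avg (s + L) \<omega> - b \<omega>) ^ 2)" by simp
  also have "\<dots> \<le> expectation (\<lambda>\<omega>. \<zeta> \<omega> * (avg r \<omega> - b \<omega>) ^ 2)"
    using r Ls by (intro second_moment_mono[OF s1 \<zeta> b]) auto
  finally have "expectation (\<lambda>\<omega>. \<zeta> \<omega> * (avg s \<omega> - b \<omega>) ^ 2) + real L * (\<kappa> * expectation \<zeta>) \<le> \<dots>" .
  moreover have "\<eta>\<^sup>2 / (288 * real s) * expectation \<zeta> \<le> real L * (\<kappa> * expectation \<zeta>)"
  proof -
    have "\<eta>\<^sup>2 / (288 * real s) = \<eta> * real s / 4 * \<kappa>"
      using s8 by (simp add: \<kappa>_def power2_eq_square divide_simps)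
    also have "\<dots> \<le> real L * \<kappa>"
      using L(2) \<eta> by (intro mult_right_mono) (auto simp: \<kappa>_def)
    finally have "\<eta>\<^sup>2 / (288 * real s) * expectation \<zeta> \<le> real L * \<kappa> * expectation \<zeta>"
      by (rule mult_right_mono) (rule expectation_nonneg[of \<zeta>, OF \<zeta>(2)])
    then show ?thesis by (simp only: mult.assoc)
  qed
  ultimately show ?thesis by linarith
qed

text \<open>
  A step at time \<open>r\<close> adds at most \<open>8 * h\<^sup>2\<close> times the second moment plus \<open>3 * h ^ 4\<close>, where
  \<open>h = 1 / (r + 3)\<close>.  The second moment is controlled by \<open>second_moment_upper\<close>, and the factors \<open>h\<^sup>2\<close> are
  summed by the telescoping bound.
\<close>

lemma fourth_moment_upper:
  assumes s: "1 \<le> s" and \<zeta>: "past_bounded s \<zeta>" "\<And>\<omega>. 0 \<le> \<zeta> \<omega>" and b: "past_bounded s b" and "s \<le> r"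
  defines "K \<equiv> 8 * expectation (\<lambda>\<omega>. \<zeta> \<omega> * ((avg s \<omega> - b \<omega>) ^ 2 + 1 / real s)) + 3 / real s * expectation \<zeta>"
  shows "expectation (\<lambda>\<omega>. \<zeta> \<omega> * (avg r \<omega> - b \<omega>) ^ 4) \<le>
    expectation (\<lambda>\<omega>. \<zeta> \<omega> * (avg s \<omega> - b \<omega>) ^ 4) + (1 / (real s + 2) - 1 / (real r + 2)) * K"
  using \<open>s \<le> r\<close>
proof (induction r rule: dec_induct)
  case (step r)
  note z = \<zeta>(1)[THEN past_bounded_mono, OF \<open>s \<le> r\<close>] b[THEN past_bounded_mono, OF \<open>s \<le> r\<close>]
  have r: "1 \<le> r" using s step.hyps by simp
  note z' = z[THEN past_bounded_mono, of "Suc r"] past_bounded_avg[THEN past_bounded_mono, of r "Suc r"]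
  have E: "0 \<le> expectation \<zeta>" using \<zeta>(2) by (rule expectation_nonneg)
  have K: "0 \<le> K" unfolding K_def using \<zeta>(2) E
    by (intro add_nonneg_nonneg mult_nonneg_nonneg expectation_nonneg) auto
  define h where "h = 1 / (real r + 3)"
  have h: "h\<^sup>2 \<le> 1 / real s" "0 \<le> h"
  proof -
    have "real s \<le> (real r + 3) ^ 2"
      using step.hyps by (simp add: power2_eq_square algebra_simps add_increasing)
    then show "h\<^sup>2 \<le> 1 / real s"
      using s by (simp add: h_def power_divide frac_le)
  qed (simp add: h_def)
  let ?W = "\<lambda>\<omega>. avg r \<omega> - b \<omega>"
  have int: "integrable M (\<lambda>\<omega>. \<zeta> \<omega> * ?W \<omega> ^ 4)" "integrable M (\<lambda>\<omega>. (4 * \<zeta> \<omega> * ?W \<omega> ^ 3) * incr r \<omega>)"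
     "integrable M (\<lambda>\<omega>. \<zeta> \<omega> * ?W \<omega> ^ 2)" "integrable M \<zeta>" "integrable M (\<lambda>\<omega>. \<zeta> \<omega> * (avg s \<omega> - b \<omega>) ^ 2)"
    using r step.hyps z' by (auto intro!: integrable_past_bounded[of "Suc r"] bdd past_bounded_mono[OF past_bounded_avg])
  have sm: "expectation (\<lambda>\<omega>. \<zeta> \<omega> * ?W \<omega> ^ 2) \<le> expectation (\<lambda>\<omega>. \<zeta> \<omega> * ((avg s \<omega> - b \<omega>) ^ 2 + 1 / real s))"
  proof -
    have "1 / (real s + 2) - 1 / (real r + 2) \<le> 1 / real s"
      using s by (smt (verit) frac_le of_nat_0_le_iff divide_nonneg_nonneg of_nat_1 of_nat_le_iff)
    from mult_right_mono[OF this E] second_moment_upper[OF s \<zeta> b \<open>s \<le> r\<close>] int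
    show ?thesis by (simp add: distrib_left)
  qed
  have "expectation (\<lambda>\<omega>. \<zeta> \<omega> * (avg (Suc r) \<omega> - b \<omega>) ^ 4) \<le>
     expectation (\<lambda>\<omega>. \<zeta> \<omega> * ?W \<omega> ^ 4 + (4 * \<zeta> \<omega> * ?W \<omega> ^ 3) * incr r \<omega> + 8 * h\<^sup>2 * (\<zeta> \<omega> * ?W \<omega> ^ 2) + 3 * h ^ 4 * \<zeta> \<omega>)"
  proof (rule integral_mono)
    fix \<omega>
    have "(?W \<omega> + incr r \<omega>) ^ 4 \<le> ?W \<omega> ^ 4 + 4 * ?W \<omega> ^ 3 * incr r \<omega> + 8 * h\<^sup>2 * ?W \<omega> ^ 2 + 3 * h ^ 4"
      using incr_bound[of r \<omega>] by (intro fourth_power_step) (simp add: h_def)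
    from mult_left_mono[OF this \<zeta>(2)[of \<omega>]]
    show "\<zeta> \<omega> * (avg (Suc r) \<omega> - b \<omega>) ^ 4 \<le> \<zeta> \<omega> * ?W \<omega> ^ 4 + (4 * \<zeta> \<omega> * ?W \<omega> ^ 3) * incr r \<omega> + 8 * h\<^sup>2 * (\<zeta> \<omega> * ?W \<omega> ^ 2) + 3 * h ^ 4 * \<zeta> \<omega>"
      using r by (simp add: avg_Suc algebra_simps)
  qed (auto intro!: integrable_past_bounded[of "Suc r"] bdd z' r)
  also have "\<dots> = expectation (\<lambda>\<omega>. \<zeta> \<omega> * ?W \<omega> ^ 4) + expectation (\<lambda>\<omega>. (4 * \<zeta> \<omega> * ?W \<omega> ^ 3) * incr r \<omega>)
      + (8 * h\<^sup>2 * expectation (\<lambda>\<omega>. \<zeta> \<omega> * ?W \<omega> ^ 2) + 3 * h ^ 4 * expectation \<zeta>)"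
    using int by simp
  also have "expectation (\<lambda>\<omega>. (4 * \<zeta> \<omega> * ?W \<omega> ^ 3) * incr r \<omega>) = 0"
    by (intro expectation_incr r bdd z)
  finally have A: "expectation (\<lambda>\<omega>. \<zeta> \<omega> * (avg (Suc r) \<omega> - b \<omega>) ^ 4) \<le> expectation (\<lambda>\<omega>. \<zeta> \<omega> * ?W \<omega> ^ 4)
      + (8 * h\<^sup>2 * expectation (\<lambda>\<omega>. \<zeta> \<omega> * ?W \<omega> ^ 2) + 3 * h ^ 4 * expectation \<zeta>)"
    by simp
  have "8 * h\<^sup>2 * expectation (\<lambda>\<omega>. \<zeta> \<omega> * ?W \<omega> ^ 2) + 3 * h ^ 4 * expectation \<zeta> \<le> h\<^sup>2 * K"
  proof -
    have "h ^ 4 \<le> h\<^sup>2 * (1 / real s)"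
      using mult_left_mono[OF h(1), of "h\<^sup>2"] by (simp add: power4_eq_xxxx power2_eq_square)
    from mult_right_mono[OF this E]
    have "3 * (h ^ 4 * expectation \<zeta>) \<le> 3 * (h\<^sup>2 * (1 / real s) * expectation \<zeta>)"
      by (intro mult_left_mono) auto
    then have "3 * h ^ 4 * expectation \<zeta> \<le> h\<^sup>2 * (3 / real s * expectation \<zeta>)"
      by (simp add: mult_ac)
    moreover have "8 * h\<^sup>2 * expectation (\<lambda>\<omega>. \<zeta> \<omega> * ?W \<omega> ^ 2) \<le>
        h\<^sup>2 * (8 * expectation (\<lambda>\<omega>. \<zeta> \<omega> * ((avg s \<omega> - b \<omega>) ^ 2 + 1 / real s)))"
      using mult_left_mono[OF sm, of "8 * h\<^sup>2"] by simp
    ultimately show ?thesis unfolding K_def by (simp only: distrib_left)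
  qed
  also have "h\<^sup>2 * K \<le> (1 / (real r + 2) - 1 / (real (Suc r) + 2)) * K"
    using inverse_square_le_telescope[of r] K by (intro mult_right_mono) (auto simp: h_def power_divide)
  finally show ?case
    using step.IH A by (simp add: algebra_simps)
qed simp

text \<open>
  Second moment method.  With \<open>w = (W - c)\<^sup>2 / v\<close>, where \<open>W\<close> is the limit of \<^const>\<open>avg\<close>, the
  function \<open>2 * l * w - l\<^sup>2 * w\<^sup>2 = 1 - (1 - l * w)\<^sup>2\<close> is at most 1 and vanishes for \<open>W = c\<close>, so it lies
  below the indicator of \<open>W \<noteq> c\<close>.  Its conditional expectation is at least \<open>2 * l * \<sigma> - 12 * l\<^sup>2\<close> by the
  moment bounds, and \<open>l = \<sigma> / 12\<close> maximises this at \<open>\<sigma>\<^sup>2 / 12\<close>.  The bounds hold for \<^const>\<open>avg\<close> at all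
  late times and pass to the limit by dominated convergence.
\<close>

lemma anti_concentration:
  assumes \<eta>: "0 < \<eta>" "\<eta> \<le> 1 / 2" and s: "4 / \<eta> \<le> real s"
    and \<zeta>: "past_bounded s \<zeta>" "\<And>\<omega>. 0 \<le> \<zeta> \<omega>"
    and supp: "\<And>\<omega> i. \<zeta> \<omega> \<noteq> 0 \<Longrightarrow> \<eta> \<le> pmean i s \<omega> \<and> pmean i s \<omega> \<le> 1 - \<eta>"
    and c: "0 \<le> c" "c \<le> 1"
  shows "(\<eta>\<^sup>2 / 288)\<^sup>2 / 12 * expectation \<zeta> \<le> expectation (\<lambda>\<omega>. \<zeta> \<omega> * of_bool (consensus \<omega> \<noteq> c))"
proof -
  define \<sigma> where "\<sigma> = \<eta>\<^sup>2 / 288"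
  define l where "l = \<sigma> / 12"
  have "8 \<le> 4 / \<eta>" using \<eta> by (simp add: field_simps)
  then have s1: "1 \<le> s" using s by linarith
  have \<sigma>: "0 \<le> \<sigma>" "\<sigma> \<le> 1" using \<eta> power_le_one[of \<eta> 2] by (auto simp: \<sigma>_def)
  define v where "v \<omega> = (avg s \<omega> - c) ^ 2 + 1 / real s" for \<omega>
  have vs: "1 / real s \<le> v \<omega>" for \<omega> by (simp add: v_def)
  have v0: "0 < v \<omega>" for \<omega> using vs[of \<omega>] s1 by (smt (verit) divide_pos_pos of_nat_0_less_iff less_le_trans zero_less_one)
  have iv: "past_bounded s (\<lambda>\<omega>. 1 / v \<omega>)"
    using s1 vs by (intro past_bounded_inverse[where \<epsilon>="1 / real s"]) (auto simp: v_def[abs_def] intro!: bdd)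
  \<comment> \<open>the normalisation by \<open>v\<close> is moved into the weights, which are still known at time \<open>s\<close>\<close>
  define \<zeta>1 where "\<zeta>1 \<omega> = \<zeta> \<omega> * (1 / v \<omega>)" for \<omega>
  define \<zeta>2 where "\<zeta>2 \<omega> = \<zeta> \<omega> * (1 / v \<omega>) ^ 2" for \<omega>
  have z1: "past_bounded s \<zeta>1" "\<And>\<omega>. 0 \<le> \<zeta>1 \<omega>"
    unfolding \<zeta>1_def[abs_def] by (intro bdd \<zeta>(1) iv) (simp add: \<zeta>(2) v0 less_imp_le)
  have z2: "past_bounded s \<zeta>2" "\<And>\<omega>. 0 \<le> \<zeta>2 \<omega>"
    unfolding \<zeta>2_def[abs_def] by (intro bdd \<zeta>(1) iv) (simp add: \<zeta>(2) v0 less_imp_le)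
  have pv: "past_bounded s v" unfolding v_def[abs_def] by (intro bdd)
  have eq1: "\<zeta>1 \<omega> * v \<omega> = \<zeta> \<omega>" and eq2: "\<zeta>2 \<omega> * v \<omega> ^ 2 = \<zeta> \<omega>" for \<omega>
    using v0[of \<omega>] by (auto simp: \<zeta>1_def \<zeta>2_def power_divide)
  have lower: "\<sigma> * expectation \<zeta> \<le> expectation (\<lambda>\<omega>. \<zeta>1 \<omega> * (avg r \<omega> - c) ^ 2)" if r: "2 * s \<le> r" for r
  proof -
    have i: "integrable M (\<lambda>\<omega>. \<zeta>1 \<omega> * (avg s \<omega> - c) ^ 2)" "integrable M \<zeta>1" "integrable M \<zeta>"
      by (intro integrable_past_bounded[of s] bdd z1 \<zeta>)+
    have "\<sigma> * expectation \<zeta> = expectation (\<lambda>\<omega>. \<sigma> * \<zeta> \<omega>)" by simp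
    also have "\<dots> \<le> expectation (\<lambda>\<omega>. \<zeta>1 \<omega> * (avg s \<omega> - c) ^ 2 + \<sigma> / real s * \<zeta>1 \<omega>)"
    proof (rule integral_mono)
      fix \<omega>
      have "\<sigma> * \<zeta> \<omega> = \<sigma> * (\<zeta>1 \<omega> * (avg s \<omega> - c) ^ 2) + \<sigma> / real s * \<zeta>1 \<omega>"
        unfolding eq1[symmetric] by (simp add: v_def algebra_simps)
      also have "\<sigma> * (\<zeta>1 \<omega> * (avg s \<omega> - c) ^ 2) \<le> 1 * (\<zeta>1 \<omega> * (avg s \<omega> - c) ^ 2)"
        using \<sigma> z1 by (intro mult_right_mono) auto
      finally show "\<sigma> * \<zeta> \<omega> \<le> \<zeta>1 \<omega> * (avg s \<omega> - c) ^ 2 + \<sigma> / real s * \<zeta>1 \<omega>" by simp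
    qed (use i in auto)
    also have "\<dots> = expectation (\<lambda>\<omega>. \<zeta>1 \<omega> * (avg s \<omega> - c) ^ 2) + \<eta>\<^sup>2 / (288 * real s) * expectation \<zeta>1"
      using i by (simp add: \<sigma>_def)
    also have "\<dots> \<le> expectation (\<lambda>\<omega>. \<zeta>1 \<omega> * (avg r \<omega> - c) ^ 2)"
      using supp by (intro second_moment_lower[OF \<eta> s z1 _ past_bounded_const r]) (auto simp: \<zeta>1_def)
    finally show ?thesis .
  qed
  have upper: "expectation (\<lambda>\<omega>. \<zeta>2 \<omega> * (avg r \<omega> - c) ^ 4) \<le> 12 * expectation \<zeta>" if r: "s \<le> r" for r
  proof -
    have i: "integrable M (\<lambda>\<omega>. \<zeta>2 \<omega> * (avg s \<omega> - c) ^ 4)" "integrable M \<zeta>2" "integrable M (\<lambda>\<omega>. \<zeta>2 \<omega> * v \<omega>)" "integrable M \<zeta>"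
      by (intro integrable_past_bounded[of s] bdd z2 \<zeta> pv)+
    let ?K = "8 * expectation (\<lambda>\<omega>. \<zeta>2 \<omega> * v \<omega>) + 3 / real s * expectation \<zeta>2"
    have K: "0 \<le> ?K"
      using z2 v0 by (intro add_nonneg_nonneg mult_nonneg_nonneg expectation_nonneg) (auto intro: less_imp_le)
    have "expectation (\<lambda>\<omega>. \<zeta>2 \<omega> * (avg r \<omega> - c) ^ 4) \<le>
      expectation (\<lambda>\<omega>. \<zeta>2 \<omega> * (avg s \<omega> - c) ^ 4) + (1 / (real s + 2) - 1 / (real r + 2)) * ?K"
      using fourth_moment_upper[OF s1 z2 past_bounded_const r] by (simp add: v_def)
    also have "\<dots> \<le> expectation (\<lambda>\<omega>. \<zeta>2 \<omega> * (avg s \<omega> - c) ^ 4) + 1 / real s * ?K"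
    proof -
      have "1 / (real s + 2) - 1 / (real r + 2) \<le> 1 / real s"
        using s1 by (smt (verit) frac_le of_nat_0_le_iff divide_nonneg_nonneg of_nat_1 of_nat_le_iff)
      from mult_right_mono[OF this K] show ?thesis by simp
    qed
    also have "\<dots> = expectation (\<lambda>\<omega>. \<zeta>2 \<omega> * (avg s \<omega> - c) ^ 4 + 8 / real s * (\<zeta>2 \<omega> * v \<omega>) + 3 / (real s) ^ 2 * \<zeta>2 \<omega>)"
      using i by (simp add: power2_eq_square distrib_left)
    also have "\<dots> \<le> expectation (\<lambda>\<omega>. 12 * \<zeta> \<omega>)"
    proof (rule integral_mono)
      fix \<omega>
      define a where "a = (avg s \<omega> - c)\<^sup>2"
      define u where "u = 1 / real s"
      have au: "v \<omega> = a + u" "0 \<le> a" "0 \<le> u" by (auto simp: a_def u_def v_def)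
      have "(avg s \<omega> - c) ^ 4 = a ^ 2" by (simp add: a_def)
      moreover have "a ^ 2 + 8 * u * v \<omega> + 3 * u ^ 2 \<le> 12 * v \<omega> ^ 2"
        using au by (simp add: power2_eq_square algebra_simps)
      ultimately have "(avg s \<omega> - c) ^ 4 + 8 / real s * v \<omega> + 3 / real s ^ 2 \<le> 12 * v \<omega> ^ 2"
        by (simp add: u_def power_divide)
      from mult_left_mono[OF this z2(2)[of \<omega>]]
      show "\<zeta>2 \<omega> * (avg s \<omega> - c) ^ 4 + 8 / real s * (\<zeta>2 \<omega> * v \<omega>) + 3 / (real s) ^ 2 * \<zeta>2 \<omega> \<le> 12 * \<zeta> \<omega>"
        using eq2[of \<omega>] by (simp add: algebra_simps)
    qed (use i in auto)
    finally show ?thesis by simp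
  qed
  define g where "g y \<omega> = 2 * l * (\<zeta>1 \<omega> * (y - c) ^ 2) - l\<^sup>2 * (\<zeta>2 \<omega> * (y - c) ^ 4)" for y \<omega>
  have main: "\<sigma>\<^sup>2 / 12 * expectation \<zeta> \<le> expectation (\<lambda>\<omega>. g (avg r \<omega>) \<omega>)" if r: "2 * s \<le> r" for r
  proof -
    have sr: "s \<le> r" using r by simp
    have i: "integrable M (\<lambda>\<omega>. \<zeta>1 \<omega> * (avg r \<omega> - c) ^ 2)" "integrable M (\<lambda>\<omega>. \<zeta>2 \<omega> * (avg r \<omega> - c) ^ 4)"
      by (intro integrable_past_bounded[of r] bdd past_bounded_mono[OF z1(1) sr] past_bounded_mono[OF z2(1) sr])+
    have "\<sigma>\<^sup>2 / 12 * expectation \<zeta> = 2 * l * (\<sigma> * expectation \<zeta>) - l\<^sup>2 * (12 * expectation \<zeta>)"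
      by (simp add: l_def power2_eq_square field_simps)
    also have "\<dots> \<le> 2 * l * expectation (\<lambda>\<omega>. \<zeta>1 \<omega> * (avg r \<omega> - c) ^ 2) - l\<^sup>2 * expectation (\<lambda>\<omega>. \<zeta>2 \<omega> * (avg r \<omega> - c) ^ 4)"
      using \<sigma> by (intro diff_mono mult_left_mono lower[OF r] upper[OF sr]) (auto simp: l_def)
    also have "\<dots> = expectation (\<lambda>\<omega>. g (avg r \<omega>) \<omega>)"
      using i by (simp add: g_def)
    finally show ?thesis .
  qed
  have meas: "\<zeta> \<in> borel_measurable M" "\<zeta>1 \<in> borel_measurable M" "\<zeta>2 \<in> borel_measurable M"
    using \<zeta> z1 z2 past_measurable by (auto simp: past_bounded_def)
  note [measurable] = meas avg_measurable consensus_measurable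
  have cons01: "0 \<le> consensus \<omega>" "consensus \<omega> \<le> 1" for \<omega> by (auto simp: consensus_def)
  obtain C1 C2 where C: "\<And>\<omega>. \<bar>\<zeta>1 \<omega>\<bar> \<le> C1" "\<And>\<omega>. \<bar>\<zeta>2 \<omega>\<bar> \<le> C2"
    using z1(1) z2(1) unfolding past_bounded_def by blast
  have gb: "\<bar>g y \<omega>\<bar> \<le> 2 * \<bar>l\<bar> * C1 + l\<^sup>2 * C2" if "0 \<le> y" "y \<le> 1" for y \<omega>
  proof -
    have y: "\<bar>y - c\<bar> \<le> 1" using that c by auto
    have p: "\<bar>(y - c) ^ n\<bar> \<le> 1" for n
      unfolding power_abs by (rule power_le_one[OF abs_ge_zero y])
    have "\<bar>\<zeta>1 \<omega> * (y - c) ^ 2\<bar> \<le> C1 * 1" "\<bar>\<zeta>2 \<omega> * (y - c) ^ 4\<bar> \<le> C2 * 1"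
      unfolding abs_mult
      by (rule mult_mono[OF C(1) p] mult_mono[OF C(2) p];
          use C[of \<omega>] abs_ge_zero[of "\<zeta>1 \<omega>"] abs_ge_zero[of "\<zeta>2 \<omega>"] in linarith)+
    then have "\<bar>2 * l * (\<zeta>1 \<omega> * (y - c) ^ 2)\<bar> \<le> 2 * \<bar>l\<bar> * C1" "\<bar>l\<^sup>2 * (\<zeta>2 \<omega> * (y - c) ^ 4)\<bar> \<le> l\<^sup>2 * C2"
      using mult_left_mono[of "\<bar>\<zeta>1 \<omega> * (y - c) ^ 2\<bar>" C1 "2 * \<bar>l\<bar>"]
        mult_left_mono[of "\<bar>\<zeta>2 \<omega> * (y - c) ^ 4\<bar>" C2 "l\<^sup>2"] by (simp_all add: abs_mult)
    then show ?thesis unfolding g_def by linarith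
  qed
  have "(\<lambda>r. expectation (\<lambda>\<omega>. g (avg r \<omega>) \<omega>)) \<longlonglongrightarrow> expectation (\<lambda>\<omega>. g (consensus \<omega>) \<omega>)"
  proof (rule integral_dominated_convergence)
    show "(\<lambda>\<omega>. g (consensus \<omega>) \<omega>) \<in> borel_measurable M" unfolding g_def by measurable
    show "(\<lambda>\<omega>. g (avg r \<omega>) \<omega>) \<in> borel_measurable M" for r unfolding g_def by measurable
    show "integrable M (\<lambda>\<omega>. 2 * \<bar>l\<bar> * C1 + l\<^sup>2 * C2)" by simp
    show "AE \<omega> in M. (\<lambda>r. g (avg r \<omega>) \<omega>) \<longlonglongrightarrow> g (consensus \<omega>) \<omega>"
      using pmean_tendsto_consensus
    proof eventually_elim
      case (elim \<omega>)
      have "(\<lambda>t. avg t \<omega>) \<longlonglongrightarrow> (consensus \<omega> + consensus \<omega>) / 2"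
        unfolding avg_def using elim by (intro tendsto_intros) auto
      then have "(\<lambda>t. avg t \<omega>) \<longlonglongrightarrow> consensus \<omega>" by simp
      then show ?case unfolding g_def by (intro tendsto_intros)
    qed
    show "AE \<omega> in M. norm (g (avg r \<omega>) \<omega>) \<le> 2 * \<bar>l\<bar> * C1 + l\<^sup>2 * C2" for r
      unfolding real_norm_def by (intro AE_I2 gb less_imp_le avg_bounds)
  qed
  then have "\<sigma>\<^sup>2 / 12 * expectation \<zeta> \<le> expectation (\<lambda>\<omega>. g (consensus \<omega>) \<omega>)"
    by (rule LIMSEQ_le_const) (use main in blast)
  also have "\<dots> \<le> expectation (\<lambda>\<omega>. \<zeta> \<omega> * of_bool (consensus \<omega> \<noteq> c))"
  proof (rule integral_mono)
    show "integrable M (\<lambda>\<omega>. g (consensus \<omega>) \<omega>)"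
      using gb[OF cons01] by (intro integrable_bounded[where C="2 * \<bar>l\<bar> * C1 + l\<^sup>2 * C2"]) (simp_all add: g_def)
    show "integrable M (\<lambda>\<omega>. \<zeta> \<omega> * of_bool (consensus \<omega> \<noteq> c))"
      by (rule Bochner_Integration.integrable_bound[OF integrable_past_bounded[OF \<zeta>(1)]]) auto
    fix \<omega>
    show "g (consensus \<omega>) \<omega> \<le> \<zeta> \<omega> * of_bool (consensus \<omega> \<noteq> c)"
    proof (cases "consensus \<omega> = c")
      case False
      define d where "d = (consensus \<omega> - c)\<^sup>2"
      define e where "e = 1 / v \<omega>"
      have "(consensus \<omega> - c) ^ 4 = d ^ 2" by (simp add: d_def)
      then have "g (consensus \<omega>) \<omega> = 2 * l * (\<zeta> \<omega> * e * d) - l\<^sup>2 * (\<zeta> \<omega> * e ^ 2 * d ^ 2)"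
        by (simp only: g_def \<zeta>1_def \<zeta>2_def d_def e_def)
      also have "\<dots> = \<zeta> \<omega> * (1 - (1 - l * (d * e)) ^ 2)"
        by (simp add: power2_eq_square algebra_simps)
      also have "\<dots> \<le> \<zeta> \<omega> * 1"
        using \<zeta>(2) by (intro mult_left_mono) auto
      finally show ?thesis using False by simp
    qed (simp add: g_def)
  qed
  finally show ?thesis unfolding \<sigma>_def .
qed

text \<open>
  The weight \<open>\<zeta> s\<close> is a product of tent functions of width \<open>1 / n\<close> around \<open>c\<close> evaluated at the two means
  at time \<open>s\<close>; for large \<open>n\<close> it vanishes unless both means are close to \<open>c\<close>, hence away from 0 and 1.  As
  \<open>s\<close> grows, the weight tends to \<open>\<psi> n\<close>, the same function of the limit, and as \<open>n\<close> grows, \<open>\<psi> n\<close> tends to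
  the indicator of the event that the limit equals \<open>c\<close>.  In the double limit \<open>anti_concentration\<close>
  bounds \<open>\<delta>\<close> times the probability of this event by 0.
\<close>

lemma consensus_no_atom:
  assumes c: "0 < c" "c < 1"
  shows "AE \<omega> in M. consensus \<omega> \<noteq> c"
proof -
  define \<eta> where "\<eta> = min c (1 - c) / 2"
  have \<eta>: "0 < \<eta>" "\<eta> \<le> 1 / 2" "2 * \<eta> \<le> c" "c \<le> 1 - 2 * \<eta>" using c by (auto simp: \<eta>_def)
  define \<delta> where "\<delta> = (\<eta>\<^sup>2 / 288)\<^sup>2 / 12"
  have \<delta>: "0 < \<delta>" using \<eta> by (simp add: \<delta>_def)
  define \<phi> where "\<phi> n y = max 0 (1 - real n * \<bar>y - c\<bar>)" for n and y :: real
  have \<phi>01: "0 \<le> \<phi> n y" "\<phi> n y \<le> 1" for n y by (auto simp: \<phi>_def)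
  have [measurable]: "\<phi> n \<in> borel_measurable borel" for n unfolding \<phi>_def by measurable
  have \<phi>c: "(\<lambda>t. \<phi> n (a t)) \<longlonglongrightarrow> \<phi> n b" if "a \<longlonglongrightarrow> b" for n a b
    unfolding \<phi>_def by (intro tendsto_intros that)
  note [measurable] = consensus_measurable past_measurable[OF pmean_past_measurable]
  define \<psi> where "\<psi> n \<omega> = \<phi> n (consensus \<omega>) * \<phi> n (consensus \<omega>)" for n \<omega>
  have near: "\<delta> * expectation (\<psi> n) \<le> expectation (\<lambda>\<omega>. \<psi> n \<omega> * of_bool (consensus \<omega> \<noteq> c))"
    if n: "1 / \<eta> \<le> real n" for n
  proof -
    define \<zeta> where "\<zeta> s \<omega> = \<phi> n (pmean Agent1 s \<omega>) * \<phi> n (pmean Agent2 s \<omega>)" for s \<omega>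
    have \<zeta>01: "0 \<le> \<zeta> s \<omega>" "\<zeta> s \<omega> \<le> 1" for s \<omega>
      by (auto simp: \<zeta>_def \<phi>01 intro!: mult_le_one)
    have [measurable]: "\<zeta> s \<in> borel_measurable M" for s unfolding \<zeta>_def[abs_def] by measurable
    have \<zeta>pb: "past_bounded s (\<zeta> s)" for s
    proof -
      note [measurable] = pmean_past_measurable[of _ s]
      have "\<zeta> s \<in> borel_measurable (\<F> s)" unfolding \<zeta>_def[abs_def] by measurable
      then show ?thesis unfolding past_bounded_def using \<zeta>01 by (auto intro!: exI[of _ 1])
    qed
    have supp: "\<eta> \<le> pmean i s \<omega> \<and> pmean i s \<omega> \<le> 1 - \<eta>" if "\<zeta> s \<omega> \<noteq> 0" for i s \<omega>
    proof -
      have "\<phi> n (pmean i s \<omega>) \<noteq> 0" using that by (cases i) (auto simp: \<zeta>_def)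
      then have "real n * \<bar>pmean i s \<omega> - c\<bar> < 1" by (auto simp: \<phi>_def max_def split: if_splits)
      moreover have "1 / \<eta> * \<bar>pmean i s \<omega> - c\<bar> \<le> real n * \<bar>pmean i s \<omega> - c\<bar>"
        using n by (intro mult_right_mono) auto
      ultimately have "1 / \<eta> * \<bar>pmean i s \<omega> - c\<bar> < 1" by linarith
      then have "\<bar>pmean i s \<omega> - c\<bar> < \<eta>" using \<eta> by (simp add: field_simps)
      then show ?thesis using \<eta> by linarith
    qed
    have \<zeta>lim: "AE \<omega> in M. (\<lambda>s. \<zeta> s \<omega>) \<longlonglongrightarrow> \<psi> n \<omega>"
      using pmean_tendsto_consensus
    proof eventually_elim
      case (elim \<omega>)
      then show ?case unfolding \<zeta>_def \<psi>_def by (intro tendsto_mult \<phi>c) auto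
    qed
    have 1: "(\<lambda>s. expectation (\<zeta> s)) \<longlonglongrightarrow> expectation (\<psi> n)"
      using \<zeta>lim \<zeta>01 by (intro integral_dominated_convergence[where w="\<lambda>_. 1"]) (auto simp: \<psi>_def[abs_def])
    have 2: "(\<lambda>s. expectation (\<lambda>\<omega>. \<zeta> s \<omega> * of_bool (consensus \<omega> \<noteq> c))) \<longlonglongrightarrow>
        expectation (\<lambda>\<omega>. \<psi> n \<omega> * of_bool (consensus \<omega> \<noteq> c))"
    proof (rule integral_dominated_convergence[where w="\<lambda>_. 1"])
      show "AE \<omega> in M. (\<lambda>s. \<zeta> s \<omega> * of_bool (consensus \<omega> \<noteq> c)) \<longlonglongrightarrow> \<psi> n \<omega> * of_bool (consensus \<omega> \<noteq> c)"
        using \<zeta>lim by eventually_elim (intro tendsto_mult tendsto_const)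
      show "AE \<omega> in M. norm (\<zeta> s \<omega> * of_bool (consensus \<omega> \<noteq> c)) \<le> 1" for s
        using \<zeta>01 by auto
    qed (auto simp: \<psi>_def[abs_def])
    show ?thesis
    proof (rule LIMSEQ_le[OF tendsto_mult[OF tendsto_const 1] 2])
      obtain N where N: "4 / \<eta> \<le> real N" using real_arch_simple by blast
      have "\<delta> * expectation (\<zeta> s) \<le> expectation (\<lambda>\<omega>. \<zeta> s \<omega> * of_bool (consensus \<omega> \<noteq> c))" if "N \<le> s" for s
        unfolding \<delta>_def using that N c by (intro anti_concentration[OF \<eta>(1,2) _ \<zeta>pb \<zeta>01(1) supp]) auto
      then show "\<exists>N. \<forall>s\<ge>N. \<delta> * expectation (\<zeta> s) \<le> expectation (\<lambda>\<omega>. \<zeta> s \<omega> * of_bool (consensus \<omega> \<noteq> c))"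
        by blast
    qed
  qed
  have \<psi>lim: "(\<lambda>n. \<psi> n \<omega>) \<longlonglongrightarrow> of_bool (consensus \<omega> = c)" for \<omega>
  proof (cases "consensus \<omega> = c")
    case False
    obtain N where N: "1 / \<bar>consensus \<omega> - c\<bar> \<le> real N" using real_arch_simple by blast
    have "\<psi> n \<omega> = 0" if "N \<le> n" for n
    proof -
      have "1 / \<bar>consensus \<omega> - c\<bar> \<le> real n" using N that by linarith
      then have "1 \<le> real n * \<bar>consensus \<omega> - c\<bar>" using False by (simp add: field_simps)
      then show ?thesis by (simp add: \<psi>_def \<phi>_def)
    qed
    then show ?thesis using False by (intro tendsto_eventually) (auto simp: eventually_sequentially)
  qed (simp add: \<psi>_def \<phi>_def)
  have \<psi>01: "0 \<le> \<psi> n \<omega>" "\<psi> n \<omega> \<le> 1" for n \<omega>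
    by (auto simp: \<psi>_def \<phi>01 intro!: mult_le_one)
  have 1: "(\<lambda>n. expectation (\<psi> n)) \<longlonglongrightarrow> expectation (\<lambda>\<omega>. of_bool (consensus \<omega> = c) :: real)"
    using \<psi>lim \<psi>01 by (intro integral_dominated_convergence[where w="\<lambda>_. 1"]) (auto simp: \<psi>_def[abs_def])
  have 2: "(\<lambda>n. expectation (\<lambda>\<omega>. \<psi> n \<omega> * of_bool (consensus \<omega> \<noteq> c))) \<longlonglongrightarrow> expectation (\<lambda>\<omega>. 0)"
  proof (rule integral_dominated_convergence[where w="\<lambda>_. 1"])
    have "(\<lambda>n. \<psi> n \<omega> * of_bool (consensus \<omega> \<noteq> c)) \<longlonglongrightarrow> of_bool (consensus \<omega> = c) * of_bool (consensus \<omega> \<noteq> c)" for \<omega>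
      by (intro tendsto_mult \<psi>lim tendsto_const)
    moreover have "of_bool (consensus \<omega> = c) * of_bool (consensus \<omega> \<noteq> c) = (0 :: real)" for \<omega>
      by simp
    ultimately show "AE \<omega> in M. (\<lambda>n. \<psi> n \<omega> * of_bool (consensus \<omega> \<noteq> c)) \<longlonglongrightarrow> 0"
      by (intro AE_I2) metis
    show "AE \<omega> in M. norm (\<psi> n \<omega> * of_bool (consensus \<omega> \<noteq> c)) \<le> 1" for n
      using \<psi>01 by auto
  qed (auto simp: \<psi>_def[abs_def])
  obtain N where N: "1 / \<eta> \<le> real N" using real_arch_simple by blast
  have "\<delta> * expectation (\<lambda>\<omega>. of_bool (consensus \<omega> = c) :: real) \<le> expectation (\<lambda>\<omega>. 0)"
    by (rule LIMSEQ_le[OF tendsto_mult[OF tendsto_const 1] 2])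
       (use N near in \<open>auto intro!: exI[of _ N] intro: order_trans\<close>)
  then have "expectation (\<lambda>\<omega>. of_bool (consensus \<omega> = c) :: real) \<le> 0"
    using \<delta> by (simp add: mult_le_0_iff)
  moreover have "expectation (\<lambda>\<omega>. of_bool (consensus \<omega> = c) :: real) \<ge> 0"
    by (intro expectation_nonneg) auto
  ultimately have "expectation (\<lambda>\<omega>. of_bool (consensus \<omega> = c) :: real) = 0" by simp
  then have "AE \<omega> in M. (of_bool (consensus \<omega> = c) :: real) = 0"
    by (subst (asm) integral_nonneg_eq_0_iff_AE) (auto intro!: integrable_bounded[where C=1])
  then show ?thesis by eventually_elim auto
qed

lemma AE_state: "AE \<omega> in M. 0 < \<theta> \<omega> \<and> \<theta> \<omega> < 1"
proof -
  have "AE x in lborel. x \<noteq> (0::real) \<and> x \<noteq> 1"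
    using AE_lborel_singleton[of "0::real"] AE_lborel_singleton[of "1::real"] by eventually_elim auto
  then have "AE x in uniform_measure lborel {0..1::real}. 0 < x \<and> x < 1"
  proof (intro AE_uniform_measureI)
    show "AE x in lborel. x \<in> {0..1::real} \<longrightarrow> 0 < x \<and> x < 1"
      using \<open>AE x in lborel. x \<noteq> (0::real) \<and> x \<noteq> 1\<close> by eventually_elim auto
  qed simp
  then have "AE x in distr M borel \<theta>. 0 < x \<and> x < 1"
    unfolding state .
  then show ?thesis
    using measurable_state by (subst (asm) AE_distr_iff) auto
qed

text \<open>
  The conditional expectation is constant on the four events on which both signals are fixed, and it lies
  strictly between 0 and 1 because the state does; so finitely many values have to be avoided, none of
  which is an atom of the limit.
\<close>

lemma consensus_ne_bayes: "AE \<omega> in M. consensus \<omega> \<noteq> bayes_posterior_mean M \<theta> S \<omega>"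
proof -
  let ?f = "\<lambda>\<omega>. (S Agent1 \<omega>, S Agent2 \<omega>)"
  let ?G = "vimage_algebra (space M) ?f (count_space UNIV)"
  let ?b = "bayes_posterior_mean M \<theta> S"
  have f: "?f \<in> measurable M (count_space UNIV)"
  proof -
    have "?f \<in> measurable M (count_space UNIV \<Otimes>\<^sub>M count_space UNIV)"
      by (intro measurable_Pair measurable_signal)
    then show ?thesis by (simp add: pair_measure_countable)
  qed
  have sub: "subalgebra M ?G"
    using f by (auto simp: subalgebra_def sets_vimage_algebra2)
  interpret finite_measure_subalgebra M ?G by unfold_locales fact
  have int: "integrable M \<theta>"
  proof (rule integrable_const_bound[where B=1])
    show "AE \<omega> in M. norm (\<theta> \<omega>) \<le> 1" using AE_state by eventually_elim auto
  qed (rule measurable_state)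
  have b01: "AE \<omega> in M. 0 < ?b \<omega> \<and> ?b \<omega> < 1"
  proof -
    have "AE \<omega> in M. 0 < ?b \<omega>" "AE \<omega> in M. ?b \<omega> < 1"
      unfolding bayes_posterior_mean_def
      by (rule real_cond_exp_gr_c[OF int] real_cond_exp_less_c[OF int],
          use AE_state in \<open>eventually_elim, simp\<close>)+
    then show ?thesis by eventually_elim auto
  qed
  have "?b \<in> borel_measurable ?G" unfolding bayes_posterior_mean_def by simp
  note fibre = measurable_vimage_fibre[OF this]
  have "?b ` space M \<subseteq> (\<lambda>z. ?b (SOME \<omega>. \<omega> \<in> space M \<and> ?f \<omega> = z)) ` UNIV"
  proof
    fix y assume "y \<in> ?b ` space M"
    then obtain \<omega> where \<omega>: "\<omega> \<in> space M" "y = ?b \<omega>" by auto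
    let ?\<omega>' = "SOME \<omega>'. \<omega>' \<in> space M \<and> ?f \<omega>' = ?f \<omega>"
    have "?\<omega>' \<in> space M \<and> ?f ?\<omega>' = ?f \<omega>" 
      by (rule someI[of "\<lambda>\<omega>'. \<omega>' \<in> space M \<and> ?f \<omega>' = ?f \<omega>" \<omega>]) (use \<omega>(1) in simp)
    then have "?b \<omega> = ?b ?\<omega>'" using \<omega>(1) by (intro fibre) auto
    then show "y \<in> (\<lambda>z. ?b (SOME \<omega>. \<omega> \<in> space M \<and> ?f \<omega> = z)) ` UNIV"
      unfolding \<omega>(2) by (rule image_eqI) simp
  qed
  then have fin: "finite (?b ` space M)" by (rule finite_subset) simp
  have "AE \<omega> in M. \<forall>c\<in>?b ` space M \<inter> {0<..<1}. consensus \<omega> \<noteq> c"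
    using fin by (intro AE_finite_allI consensus_no_atom) auto
  with b01 AE_space show ?thesis
    by eventually_elim auto
qed

lemma misspec_posterior_weak_conv:
  assumes "\<forall>i. (\<lambda>t. pmean i t \<omega>) \<longlonglongrightarrow> L"
  shows "weak_conv_m (\<lambda>t. misspec_posterior S X i t \<omega>) (return borel L)"
  unfolding misspec_posterior_obs
proof (rule bernoulli_posterior_weak_conv)
  have "filterlim (\<lambda>t::nat. t) at_top sequentially" by (rule filterlim_ident)
  then show "filterlim (\<lambda>t. length (obs i t \<omega>)) at_top sequentially"
    by (rule filterlim_mono_eventually)
       (auto simp: length_obs intro!: eventually_sequentiallyI[of 1])
  show "(\<lambda>t. post_mean (obs i t \<omega>)) \<longlonglongrightarrow> L"
    using assms by (simp add: pmean_def)
qed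

end

theorem proposition2p10:
  fixes M :: "'a measure"
    and \<theta> :: "'a \<Rightarrow> real"
    and S :: "agent \<Rightarrow> 'a \<Rightarrow> bool"
    and Y :: "agent \<Rightarrow> nat \<Rightarrow> 'a \<Rightarrow> real"
    and X :: "agent \<Rightarrow> nat \<Rightarrow> 'a \<Rightarrow> bool"
  assumes "misspecified_bernoulli_sampling M \<theta> S Y X"
  shows "\<exists>M_inf \<in> borel_measurable M.
           (\<forall>\<omega>\<in>space M. M_inf \<omega> \<in> {0..1}) \<and>
           (AE \<omega> in M. \<forall>i. weak_conv_m (\<lambda>t. misspec_posterior S X i t \<omega>) (return borel (M_inf \<omega>))) \<and>
           measure M {\<omega>\<in>space M. M_inf \<omega> \<noteq> bayes_posterior_mean M \<theta> S \<omega>} = 1"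
proof -
  interpret misspecified_bernoulli_sampling M \<theta> S Y X by fact
  have [measurable]: "bayes_posterior_mean M \<theta> S \<in> borel_measurable M"
    unfolding bayes_posterior_mean_def by simp
  note [measurable] = consensus_measurable
  show ?thesis
  proof (intro bexI[of _ consensus] conjI ballI)
    show "consensus \<omega> \<in> {0..1}" for \<omega> by (auto simp: consensus_def)
    show "AE \<omega> in M. \<forall>i. weak_conv_m (\<lambda>t. misspec_posterior S X i t \<omega>) (return borel (consensus \<omega>))"
      using pmean_tendsto_consensus by eventually_elim (auto intro: misspec_posterior_weak_conv)
    have "{\<omega> \<in> space M. consensus \<omega> \<noteq> bayes_posterior_mean M \<theta> S \<omega>} \<in> events"
      by measurable
    then show "measure M {\<omega> \<in> space M. consensus \<omega> \<noteq> bayes_posterior_mean M \<theta> S \<omega>} = 1"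
      using consensus_ne_bayes by (subst prob_Collect_eq_1) auto
  qed (rule consensus_measurable)
qed

end
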